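(* For every $f\in\mathbb G(\Omega_{\mathbb X})$ there exists a parametrized measure $\nu^f:\Omega\to\mathbb M(\mathbb R)$ such that, for all $\Psi\in C^0_b(\mathbb R)$ and all $\varphi\in C^0_c(\Omega)$, $${}^\circ\langle{}^*\Psi(f),{}^*\varphi\rangle=\int_\Omega\Big(\int_{\mathbb R}\Psi\,d\nu^f_x\Big)\varphi(x)\,dx .$$ Moreover, for all $x\in\Omega$ and all Borel $A\subseteq\mathbb R$, $0\le\nu^f_x(A)\le1$.
   Context: Work in a nonstandard extension $A\mapsto{}^*A$ of the standard universe that is saturated for families of at most $|\mathscr D'(\Omega)|$ internal sets; ${}^\circ x$ is the standard part of a finite hyperreal $x$. Fix an infinite $N_0\in{}^*\mathbb N$, let $N=N_0!$, $\varepsilon=1/N$, and $\mathbb X=\{n\varepsilon: n\in{}^*\mathbb Z,\ -N^2\le n\le N^2\}$. Let $\Omega\subseteq\mathbb R^k$ be open and $\Omega_{\mathbb X}={}^*\Omega\cap\mathbb X^k$. $\mathbb G(\Omega_{\mathbb X})$ is the set of internal functions $\Omega_{\mathbb X}\to{}^*\mathbb R$. $\langle f,g\rangle=\varepsilon^k\sum_{x\in\Omega_{\mathbb X}}f(x)g(x)$, with ${}^*\varphi$ restricted to $\Omega_{\mathbb X}$; ${}^*\Psi(f)$ is the composition ${}^*\Psi\circ f$. $C^0_b(\mathbb R)$ denotes the continuous bounded functions $\Psi$ with $\lim_{|x|\to\infty}\Psi(x)=0$. $C^0_c(\Omega)$ denotes continuous functions with compact support in $\Omega$. $\mathbb M(\mathbb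 R)$ is the set of Radon measures $\nu$ on $\mathbb R$ with $|\nu|(\mathbb R)<\infty$. A parametrized measure is a measurable map $\nu:\Omega\to\mathbb M(\mathbb R)$, $x\mapsto\nu_x$ (i.e. $x\mapsto\int\Psi\,d\nu_x$ is measurable for every $\Psi\in C^0_b(\mathbb R)$). *)

theory Defs
  imports "HOL-Analysis.Analysis" "HOL-Library.Equipollence"
begin

section \<open>The standard universe\<close>

text \<open>
  The superstructure over the urelements \<open>\<real> \<uplus> \<real>\<^sup>k\<close>, with ordered pairs kept primitive:
  \<open>V\<^sub>0\<close> consists of the urelements, and \<open>V\<^sub>n\<^sub>+\<^sub>1\<close> of the urelements, the pairs of elements of
  \<open>V\<^sub>n\<close> and the subsets of \<open>V\<^sub>n\<close>. HOL has no type that is closed under power sets, so the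
  hierarchy is cut off at \<open>V\<^sub>5\<close>. Graphs of functions from \<open>\<real>\<^sup>k\<close> to \<open>\<real>\<close> are elements of
  \<open>V\<^sub>2\<close>, functionals on them (distributions, for instance) are elements of \<open>V\<^sub>4\<close>, and sets of
  such functionals are elements of \<open>V\<^sub>5\<close>. A nonstandard extension of the full superstructure
  restricts to one of \<open>V\<^sub>5\<close>.
\<close>

datatype 'n urelem = Scalar real | Point "real ^ ('n::finite)"

datatype ('a, 'v) layer = Ur 'a | Pr 'v 'v | St "'v set"

type_synonym 'n V1 = "('n urelem, 'n urelem) layer"
type_synonym 'n V2 = "('n urelem, 'n V1) layer"
type_synonym 'n V3 = "('n urelem, 'n V2) layer"
type_synonym 'n V4 = "('n urelem, 'n V3) layer"
type_synonym 'n universe = "('n urelem, 'n V4) layer"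

fun lift_layer :: "('v \<Rightarrow> 'u) \<Rightarrow> ('a, 'v) layer \<Rightarrow> ('a, 'u) layer" where
  "lift_layer h (Ur a) = Ur a"
| "lift_layer h (Pr x y) = Pr (h x) (h y)"
| "lift_layer h (St A) = St (h ` A)"

definition incl :: "('n::finite) V4 \<Rightarrow> 'n universe" where
  "incl = lift_layer (lift_layer (lift_layer (lift_layer Ur)))"

definition mem :: "('n::finite) universe \<Rightarrow> 'n universe \<Rightarrow> bool" where
  "mem x y \<longleftrightarrow> (\<exists>A. y = St A \<and> x \<in> incl ` A)"

text \<open>The ordered pair; meaningful for \<open>x\<close> and \<open>y\<close> in \<open>V\<^sub>4\<close>.\<close>
definition opair :: "('n::finite) universe \<Rightarrow> 'n universe \<Rightarrow> 'n universe" where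
  "opair x y = (THE p. \<exists>a b. x = incl a \<and> y = incl b \<and> p = Pr a b)"

definition num :: "real \<Rightarrow> ('n::finite) universe" where
  "num r = Ur (Scalar r)"

definition pnt :: "real ^ 'n \<Rightarrow> ('n::finite) universe" where
  "pnt p = Ur (Point p)"

fun val :: "('n::finite) universe \<Rightarrow> real" where
  "val (Ur (Scalar r)) = r"
| "val _ = 0"

fun vec_val :: "('n::finite) universe \<Rightarrow> real ^ 'n" where
  "vec_val (Ur (Point p)) = p"
| "vec_val _ = 0"

fun second_val :: "('n::finite) universe \<Rightarrow> real" where
  "second_val (Pr a b) = val (incl b)"
| "second_val _ = 0"

text \<open>For the graph \<open>b\<close> of a real-valued function with finite domain: the sum of its values.\<close>
definition graph_sum :: "('n::finite) universe \<Rightarrow> real" where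
  "graph_sum b = (\<Sum>p | mem p b. second_val p)"


section \<open>Nonstandard extensions\<close>

text \<open>
  First-order formulas over the complete structure on \<open>'u\<close>: every finitary relation on \<open>'u\<close>
  (a set of lists) is a relation symbol. Variables are natural numbers. Quantifiers range over
  the whole universe, which, like each \<open>V\<^sub>n\<close>, is a set; bounded quantifiers are obtained by
  relativization. Since sets and functions are elements of \<open>V\<^sub>5\<close>, quantification over them is
  covered.
\<close>

datatype 'u formula =
    Rel "'u list set" "nat list"
  | Equal nat nat
  | Neg "'u formula"
  | Conj "'u formula" "'u formula"
  | Forall nat "'u formula"

primrec sat :: "('u list set \<Rightarrow> 'x list set) \<Rightarrow> (nat \<Rightarrow> 'x) \<Rightarrow> 'u formula \<Rightarrow> bool" where
  "sat I v (Rel R xs) \<longleftrightarrow> map v xs \<in> I R"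
| "sat I v (Equal x y) \<longleftrightarrow> v x = v y"
| "sat I v (Neg \<phi>) \<longleftrightarrow> \<not> sat I v \<phi>"
| "sat I v (Conj \<phi> \<psi>) \<longleftrightarrow> sat I v \<phi> \<and> sat I v \<psi>"
| "sat I v (Forall x \<phi>) \<longleftrightarrow> (\<forall>a. sat I (v(x := a)) \<phi>)"

text \<open>
  \<open>e\<close> sends a standard object to its nonstandard counterpart and \<open>S\<close> sends a standard relation
  \<open>R\<close> to \<open>*R\<close>; the elements of \<open>'w\<close> are the internal objects. The condition is the transfer
  principle.
\<close>
definition nonstandard_extension ::
    "('u \<Rightarrow> 'w) \<Rightarrow> ('u list set \<Rightarrow> 'w list set) \<Rightarrow> bool" where
  "nonstandard_extension e S \<longleftrightarrow> (\<forall>\<phi> v. sat (\<lambda>R. R) v \<phi> \<longleftrightarrow> sat S (e \<circ> v) \<phi>)"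

definition star_set :: "('u list set \<Rightarrow> 'w list set) \<Rightarrow> 'u set \<Rightarrow> 'w set" where
  "star_set S A = {x. [x] \<in> S {[a] | a. a \<in> A}}"

definition star_rel ::
    "('u list set \<Rightarrow> 'w list set) \<Rightarrow> ('u \<Rightarrow> 'u \<Rightarrow> bool) \<Rightarrow> 'w \<Rightarrow> 'w \<Rightarrow> bool" where
  "star_rel S R x y \<longleftrightarrow> [x, y] \<in> S {[a, b] | a b. R a b}"

definition star1 :: "('u list set \<Rightarrow> 'w list set) \<Rightarrow> ('u \<Rightarrow> 'u) \<Rightarrow> 'w \<Rightarrow> 'w" where
  "star1 S F x = (THE y. [x, y] \<in> S {[a, F a] | a. True})"

definition star2 :: "('u list set \<Rightarrow> 'w list set) \<Rightarrow> ('u \<Rightarrow> 'u \<Rightarrow> 'u) \<Rightarrow> 'w \<Rightarrow> 'w \<Rightarrow> 'w" where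
  "star2 S F x y = (THE z. [x, y, z] \<in> S {[a, b, F a b] | a b. True})"

definition internal :: "(('n::finite) universe list set \<Rightarrow> 'w list set) \<Rightarrow> 'w set \<Rightarrow> bool" where
  "internal S A \<longleftrightarrow> (\<exists>b. A = {x. star_rel S mem x b})"

definition saturated ::
    "(('n::finite) universe list set \<Rightarrow> 'w list set) \<Rightarrow> 'c set \<Rightarrow> bool" where
  "saturated S \<kappa> \<longleftrightarrow>
    (\<forall>F. (\<forall>A\<in>F. internal S A) \<and> F \<lesssim> \<kappa> \<and> (\<forall>G. G \<subseteq> F \<and> finite G \<longrightarrow> \<Inter>G \<noteq> {})
      \<longrightarrow> \<Inter>F \<noteq> {})"


section \<open>Hyperreal arithmetic\<close>

definition hyperreals :: "(('n::finite) universe list set \<Rightarrow> 'w list set) \<Rightarrow> 'w set" where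
  "hyperreals S = star_set S (range num)"

definition hfun1 ::
    "(('n::finite) universe list set \<Rightarrow> 'w list set) \<Rightarrow> (real \<Rightarrow> real) \<Rightarrow> 'w \<Rightarrow> 'w" where
  "hfun1 S g = star1 S (\<lambda>a. num (g (val a)))"

definition hfun2 ::
    "(('n::finite) universe list set \<Rightarrow> 'w list set) \<Rightarrow> (real \<Rightarrow> real \<Rightarrow> real) \<Rightarrow> 'w \<Rightarrow> 'w \<Rightarrow> 'w"
  where
  "hfun2 S g = star2 S (\<lambda>a b. num (g (val a) (val b)))"

definition hle :: "(('n::finite) universe list set \<Rightarrow> 'w list set) \<Rightarrow> 'w \<Rightarrow> 'w \<Rightarrow> bool" where
  "hle S = star_rel S (\<lambda>a b. \<exists>r s. a = num r \<and> b = num s \<and> r \<le> s)"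

definition hpfun ::
    "(('n::finite) universe list set \<Rightarrow> 'w list set) \<Rightarrow> (real ^ 'n \<Rightarrow> real) \<Rightarrow> 'w \<Rightarrow> 'w" where
  "hpfun S g = star1 S (\<lambda>a. num (g (vec_val a)))"

definition hfinite ::
    "(('n::finite) universe \<Rightarrow> 'w) \<Rightarrow> ('n universe list set \<Rightarrow> 'w list set) \<Rightarrow> 'w \<Rightarrow> bool" where
  "hfinite e S x \<longleftrightarrow>
    x \<in> hyperreals S \<and> (\<exists>r::real. hle S (e (num (- r))) x \<and> hle S x (e (num r)))"

definition std_part ::
    "(('n::finite) universe \<Rightarrow> 'w) \<Rightarrow> ('n universe list set \<Rightarrow> 'w list set) \<Rightarrow> 'w \<Rightarrow> real" where
  "std_part e S x =
    (THE r. \<forall>\<delta>>0. hle S (e (num (r - \<delta>))) x \<and> hle S x (e (num (r + \<delta>))))"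

definition infinite_hypernat ::
    "(('n::finite) universe \<Rightarrow> 'w) \<Rightarrow> ('n universe list set \<Rightarrow> 'w list set) \<Rightarrow> 'w \<Rightarrow> bool" where
  "infinite_hypernat e S x \<longleftrightarrow> x \<in> star_set S (num ` \<nat>) \<and> \<not> hfinite e S x"


section \<open>Grid functions\<close>

text \<open>\<open>N = N\<^sub>0!\<close>, the real function being the factorial on \<open>\<nat>\<close> (its other values are irrelevant).\<close>
definition grid_N :: "(('n::finite) universe list set \<Rightarrow> 'w list set) \<Rightarrow> 'w \<Rightarrow> 'w" where
  "grid_N S N0 = hfun1 S (\<lambda>r. fact (nat \<lfloor>r\<rfloor>)) N0"

definition grid_eps :: "(('n::finite) universe list set \<Rightarrow> 'w list set) \<Rightarrow> 'w \<Rightarrow> 'w" where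
  "grid_eps S N0 = hfun1 S (\<lambda>r. 1 / r) (grid_N S N0)"

definition grid :: "(('n::finite) universe list set \<Rightarrow> 'w list set) \<Rightarrow> 'w \<Rightarrow> 'w set" where
  "grid S N0 =
    {hfun2 S (*) n (grid_eps S N0) | n.
       n \<in> star_set S (num ` \<int>) \<and>
       hle S (hfun1 S (\<lambda>r. - (r ^ 2)) (grid_N S N0)) n \<and>
       hle S n (hfun1 S (\<lambda>r. r ^ 2) (grid_N S N0))}"

definition grid_dom ::
    "(('n::finite) universe list set \<Rightarrow> 'w list set) \<Rightarrow> 'w \<Rightarrow> (real ^ 'n) set \<Rightarrow> 'w set" where
  "grid_dom S N0 \<Omega> =
    {x \<in> star_set S (pnt ` \<Omega>). \<forall>i. hpfun S (\<lambda>p. p $ i) x \<in> grid S N0}"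

definition hgraph ::
    "(('n::finite) universe list set \<Rightarrow> 'w list set) \<Rightarrow> 'w set \<Rightarrow> ('w \<Rightarrow> 'w) \<Rightarrow> 'w set" where
  "hgraph S B h = {star2 S opair x (h x) | x. x \<in> B}"

definition grid_functions ::
    "(('n::finite) universe list set \<Rightarrow> 'w list set) \<Rightarrow> 'w \<Rightarrow> (real ^ 'n) set \<Rightarrow> ('w \<Rightarrow> 'w) set"
  where
  "grid_functions S N0 \<Omega> =
    {f. f \<in> grid_dom S N0 \<Omega> \<rightarrow>\<^sub>E hyperreals S \<and> internal S (hgraph S (grid_dom S N0 \<Omega>) f)}"

text \<open>
  The hyperfinite sum of an internal function \<open>h\<close> over \<open>B\<close>: the extension of \<open>graph_sum\<close>
  applied to the internal object (an element of the extension of the collection of all sets)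
  whose elements form the graph of \<open>h\<close>.
\<close>
definition hsum ::
    "(('n::finite) universe list set \<Rightarrow> 'w list set) \<Rightarrow> 'w set \<Rightarrow> ('w \<Rightarrow> 'w) \<Rightarrow> 'w" where
  "hsum S B h =
    star1 S (\<lambda>b. num (graph_sum b))
      (THE b. b \<in> star_set S (range St) \<and> {p. star_rel S mem p b} = hgraph S B h)"

definition pairing ::
    "(('n::finite) universe list set \<Rightarrow> 'w list set) \<Rightarrow> 'w \<Rightarrow> (real ^ 'n) set \<Rightarrow>
     ('w \<Rightarrow> 'w) \<Rightarrow> ('w \<Rightarrow> 'w) \<Rightarrow> 'w" where
  "pairing S N0 \<Omega> f g =
    hfun2 S (*) (hfun1 S (\<lambda>r. r ^ CARD('n)) (grid_eps S N0))
      (hsum S (grid_dom S N0 \<Omega>) (\<lambda>x. hfun2 S (*) (f x) (g x)))"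


section \<open>Test functions and distributions\<close>

definition partial :: "'n \<Rightarrow> (real ^ ('n::finite) \<Rightarrow> real) \<Rightarrow> real ^ 'n \<Rightarrow> real" where
  "partial i \<phi> x = deriv (\<lambda>t. \<phi> (x + t *\<^sub>R axis i 1)) 0"

definition iter_partial ::
    "'n list \<Rightarrow> (real ^ ('n::finite) \<Rightarrow> real) \<Rightarrow> real ^ 'n \<Rightarrow> real" where
  "iter_partial is = foldr partial is"

text \<open>All iterated partial derivatives exist and are continuous.\<close>
definition smooth :: "(real ^ ('n::finite) \<Rightarrow> real) \<Rightarrow> bool" where
  "smooth \<phi> \<longleftrightarrow>
    (\<forall>is. continuous_on UNIV (iter_partial is \<phi>) \<and>
      (\<forall>i x. (\<lambda>t. iter_partial is \<phi> (x + t *\<^sub>R axis i 1)) differentiable (at 0)))"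

definition test_functions :: "(real ^ ('n::finite)) set \<Rightarrow> (real ^ 'n \<Rightarrow> real) set" where
  "test_functions \<Omega> =
    {\<phi>. smooth \<phi> \<and> compact (closure {x. \<phi> x \<noteq> 0}) \<and> closure {x. \<phi> x \<noteq> 0} \<subseteq> \<Omega>}"

text \<open>
  Continuity of a linear functional on the space of test functions is expressed by the seminorm
  estimates on each compact \<open>K \<subseteq> \<Omega>\<close>. Functionals are \<open>undefined\<close> off the test functions, so
  that the set has the right cardinality.
\<close>
definition distributions ::
    "(real ^ ('n::finite)) set \<Rightarrow> ((real ^ 'n \<Rightarrow> real) \<Rightarrow> real) set" where
  "distributions \<Omega> =
    {T \<in> extensional (test_functions \<Omega>).
      (\<forall>\<phi>\<in>test_functions \<Omega>. \<forall>\<psi>\<in>test_functions \<Omega>. \<forall>a b.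
         T (\<lambda>x. a * \<phi> x + b * \<psi> x) = a * T \<phi> + b * T \<psi>) \<and>
      (\<forall>K. compact K \<and> K \<subseteq> \<Omega> \<longrightarrow>
        (\<exists>C m. \<forall>\<phi>\<in>test_functions \<Omega>. closure {x. \<phi> x \<noteq> 0} \<subseteq> K \<longrightarrow>
          (\<forall>M. (\<forall>is x. length is \<le> m \<longrightarrow> \<bar>iter_partial is \<phi> x\<bar> \<le> M) \<longrightarrow> \<bar>T \<phi>\<bar> \<le> C * M)))}"


section \<open>Function spaces and parametrized measures\<close>

definition C0b :: "(real \<Rightarrow> real) set" where
  "C0b = {\<Psi>. continuous_on UNIV \<Psi> \<and> bounded (range \<Psi>) \<and> (\<Psi> \<longlongrightarrow> 0) at_infinity}"

text \<open>Only the values of \<open>\<phi>\<close> on \<open>\<Omega>\<close> matter.\<close>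
definition C0c :: "(real ^ ('n::finite)) set \<Rightarrow> (real ^ 'n \<Rightarrow> real) set" where
  "C0c \<Omega> =
    {\<phi>. continuous_on \<Omega> \<phi> \<and> compact (closure {x \<in> \<Omega>. \<phi> x \<noteq> 0}) \<and>
        closure {x \<in> \<Omega>. \<phi> x \<noteq> 0} \<subseteq> \<Omega>}"

text \<open>Signed measures are real-valued set functions, considered on the Borel sets only.\<close>

definition total_variation :: "(real set \<Rightarrow> real) \<Rightarrow> real set \<Rightarrow> ennreal" where
  "total_variation \<nu> A =
    (SUP P\<in>{P. finite P \<and> disjoint P \<and> P \<subseteq> sets borel \<and> \<Union>P \<subseteq> A}. \<Sum>B\<in>P. ennreal \<bar>\<nu> B\<bar>)"

definition radon_measures :: "(real set \<Rightarrow> real) set" where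
  "radon_measures =
    {\<nu>. (\<forall>A::nat \<Rightarrow> real set. range A \<subseteq> sets borel \<and> disjoint_family A \<longrightarrow>
            (\<lambda>i. \<nu> (A i)) sums \<nu> (\<Union>i. A i)) \<and>
         (\<forall>A\<in>sets borel. \<forall>\<delta>>0. \<exists>K. compact K \<and> K \<subseteq> A \<and> total_variation \<nu> (A - K) < ennreal \<delta>) \<and>
         total_variation \<nu> UNIV < \<infinity>}"

text \<open>Positive variation; the negative variation of \<open>\<nu>\<close> is the positive variation of \<open>- \<nu>\<close>.\<close>
definition pos_variation :: "(real set \<Rightarrow> real) \<Rightarrow> real measure" where
  "pos_variation \<nu> =
    measure_of UNIV (sets borel) (\<lambda>A. SUP B\<in>{B \<in> sets borel. B \<subseteq> A}. ennreal (\<nu> B))"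

definition signed_integral :: "(real set \<Rightarrow> real) \<Rightarrow> (real \<Rightarrow> real) \<Rightarrow> real" where
  "signed_integral \<nu> \<Psi> =
    (LINT y|pos_variation \<nu>. \<Psi> y) - (LINT y|pos_variation (\<lambda>A. - \<nu> A). \<Psi> y)"

definition parametrized_measure ::
    "(real ^ ('n::finite)) set \<Rightarrow> (real ^ 'n \<Rightarrow> real set \<Rightarrow> real) \<Rightarrow> bool" where
  "parametrized_measure \<Omega> \<nu> \<longleftrightarrow>
    (\<forall>x\<in>\<Omega>. \<nu> x \<in> radon_measures) \<and>
    (\<forall>\<Psi>\<in>C0b. (\<lambda>x. signed_integral (\<nu> x) \<Psi>) \<in> borel_measurable (lebesgue_on \<Omega>))"

end

theory Submission
  imports Defs
begin

text \<open>
  The internal graph \<open>b\<close> of \<open>f\<close> together with \<open>N\<^sub>0\<close> determines an ultrafilter on standard pairs: \<open>P\<close> is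
  large iff \<open>(b, N\<^sub>0) \<in> *P\<close>. By transfer, the pairing is the extension of a standard function \<open>H\<close>
  evaluated at \<open>(b, N\<^sub>0)\<close>, and its standard part is the limit of \<open>H\<close> along the ultrafilter. It remains
  to construct a Young measure for a family of grid functions with mesh tending to \<open>0\<close> along an
  ultrafilter. For rational \<open>q\<close>, the indicators of \<open>{g \<le> q}\<close>, extended to step functions on cubes,
  have a weak-* limit \<open>W q\<close>: the limits of their integrals over sets form a set function dominated
  by a finite measure, which is therefore countably additive and has a Radon-Nikodym density. For
  almost every \<open>x\<close> the map \<open>q \<mapsto> W q x\<close> is monotone, and its Stieltjes measure is \<open>\<nu>\<^sub>x\<close>.
\<close>

section \<open>Weak-* limits along an ultrafilter\<close>

text \<open>The ultrafilter need not be countably generated, so convergence along it is not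
  sequential: there are no diagonal subsequences and no dominated convergence in the index. Every
  exchange of the limit along \<open>F\<close> with an integral or a second limit therefore rests on
  an estimate that is uniform in the index. Half-line indicators replace the functions
  \<open>\<Psi>\<close> because their weak limits depend on one real parameter, so that
  \<open>interval_measure\<close> yields a measure without representing functionals; rational
  parameters keep the exceptional sets countable in number. This has two costs. The weak limits need
  not be right continuous in the parameter, so the Stieltjes function is a right limit whose jumps
  have to be controlled. Indicators are not continuous, so \<open>\<Psi>\<close> is reached by
  uniform approximation with step functions, which is where the decay of \<open>\<Psi>\<close> at
  infinity enters. Values of \<open>f\<close> may be infinite and mass may be lost, so the measures
  have total mass at most 1.\<close>

definition is_ultrafilter :: "'i filter \<Rightarrow> bool" where
  "is_ultrafilter F \<longleftrightarrow> F \<noteq> bot \<and> (\<forall>P. eventually P F \<or> eventually (\<lambda>i. \<not> P i) F)"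

text \<open>Compactness of \<open>{-C..C}\<close> supplies a cluster point \<open>L\<close>; an
  ultrafilter decides whether \<open>a\<close> lies in a given neighbourhood of \<open>L\<close>,
  and a negative decision would contradict clustering.\<close>

lemma ultrafilter_bounded_tendsto:
  fixes a :: "'i \<Rightarrow> real"
  assumes F: "is_ultrafilter F" and b: "\<And>i. \<bar>a i\<bar> \<le> C"
  obtains L where "(a \<longlongrightarrow> L) F"
proof -
  have "filtermap a F \<noteq> bot" using F by (auto simp: is_ultrafilter_def filtermap_bot_iff)
  moreover have "eventually (\<lambda>x. x \<in> {-C..C}) (filtermap a F)"
    unfolding eventually_filtermap using b by (auto intro!: always_eventually simp: abs_le_iff) (smt (verit) b)
  ultimately obtain L where L: "inf (nhds L) (filtermap a F) \<noteq> bot"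
    using compact_Icc[of "-C" C] unfolding compact_filter by blast
  have "(a \<longlongrightarrow> L) F"
  proof (rule topological_tendstoI)
    fix U :: "real set" assume U: "open U" "L \<in> U"
    show "eventually (\<lambda>i. a i \<in> U) F"
    proof (rule ccontr)
      assume "\<not> ?thesis"
      then have "eventually (\<lambda>i. a i \<notin> U) F" using F unfolding is_ultrafilter_def by blast
      then have "eventually (\<lambda>x. x \<notin> U) (filtermap a F)" by (simp add: eventually_filtermap)
      moreover have "eventually (\<lambda>x. x \<in> U) (nhds L)" using U eventually_nhds by blast
      ultimately have "eventually (\<lambda>x. False) (inf (nhds L) (filtermap a F))"
        unfolding eventually_inf by blast
      then show False using L by (simp add: eventually_False)
    qed
  qed
  then show thesis by (rule that)
qed

text \<open>Additivity and the bound by \<open>M\<close> pass from the integrals to their limits.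
  The bound is kept in the conclusion because it later gives both absolute continuity and a density
  of at most 1.\<close>

lemma ultrafilter_set_limit_measure:
  fixes w :: "'i \<Rightarrow> 'a \<Rightarrow> real"
  assumes F: "is_ultrafilter F" and M: "finite_measure M"
    and w: "\<And>i. w i \<in> borel_measurable M" and w01: "\<And>i x. 0 \<le> w i x \<and> w i x \<le> 1"
  shows "\<exists>N. sets N = sets M \<and> (\<forall>A\<in>sets M. emeasure N A \<le> emeasure M A) \<and>
    (\<forall>A\<in>sets M. ((\<lambda>i. LINT x|M. w i x * indicator A x) \<longlongrightarrow> measure N A) F)"
proof -
  interpret finite_measure M by fact
  note w[measurable]
  have nb: "F \<noteq> bot" using F by (simp add: is_ultrafilter_def)
  have int: "integrable M (\<lambda>x. w i x * indicator A x)" if [measurable]: "A \<in> sets M" for i A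
    by (rule integrable_const_bound[where B=1]) (use w01 in \<open>auto intro!: AE_I2 simp: indicator_def\<close>)
  have bd: "0 \<le> (LINT x|M. w i x * indicator A x)" "(LINT x|M. w i x * indicator A x) \<le> measure M A"
    if [measurable]: "A \<in> sets M" for i A
  proof -
    show "0 \<le> (LINT x|M. w i x * indicator A x)"
      by (rule integral_nonneg_AE) (use w01 in auto)
    have "(LINT x|M. w i x * indicator A x) \<le> (LINT x|M. indicator A x)"
    proof (rule integral_mono[OF int[OF that]])
      show "integrable M (\<lambda>x. indicator A x :: real)"
        using that by (intro integrable_real_indicator) (auto simp: less_top[symmetric])
    qed (use w01 in \<open>auto simp: indicator_def\<close>)
    then show "(LINT x|M. w i x * indicator A x) \<le> measure M A" using that by simp
  qed
  have "\<exists>L. ((\<lambda>i. LINT x|M. w i x * indicator A x) \<longlongrightarrow> L) F" if "A \<in> sets M" for A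
    using ultrafilter_bounded_tendsto[OF F, of "\<lambda>i. LINT x|M. w i x * indicator A x" "measure M A"] bd[OF that]
    by (metis abs_of_nonneg)
  then obtain m where m: "\<And>A. A \<in> sets M \<Longrightarrow> ((\<lambda>i. LINT x|M. w i x * indicator A x) \<longlongrightarrow> m A) F"
    by metis
  have m0: "0 \<le> m A" if "A \<in> sets M" for A
    by (rule tendsto_lowerbound[OF m[OF that] _ nb]) (use bd[OF that] in simp)
  have m1: "m A \<le> measure M A" if "A \<in> sets M" for A
    by (rule tendsto_upperbound[OF m[OF that] _ nb]) (use bd[OF that] in simp)
  have madd: "m (A \<union> B) = m A + m B" if AB: "A \<in> sets M" "B \<in> sets M" "A \<inter> B = {}" for A B
  proof (rule tendsto_unique[OF nb m])
    have "(LINT x|M. w i x * indicator (A \<union> B) x) =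
      (LINT x|M. w i x * indicator A x) + (LINT x|M. w i x * indicator B x)" for i
      unfolding Bochner_Integration.integral_add[OF int[OF AB(1)] int[OF AB(2)], symmetric]
      by (rule Bochner_Integration.integral_cong) (use AB in \<open>auto simp: indicator_def\<close>)
    then show "((\<lambda>i. LINT x|M. w i x * indicator (A \<union> B) x) \<longlongrightarrow> m A + m B) F"
      using tendsto_add[OF m[OF AB(1)] m[OF AB(2)]] by simp
  qed (use AB in auto)
  define N where "N = measure_of (space M) (sets M) (\<lambda>A. ennreal (m A))"
  have sN: "sets N = sets M" by (simp add: N_def)
  have pos: "positive (sets M) (\<lambda>A. ennreal (m A))"
    using m0[of "{}"] m1[of "{}"] by (simp add: positive_def)
  \<comment> \<open>Domination by \<open>M\<close> makes \<open>m\<close> continuous at \<open>{}\<close>.\<close>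
  have cadd: "countably_additive (sets M) (\<lambda>A. ennreal (m A))"
  proof (rule sets.empty_continuous_imp_countably_additive[OF pos])
    show "additive (sets M) (\<lambda>A. ennreal (m A))"
      unfolding additive_def using madd m0 by auto
    fix A :: "nat \<Rightarrow> 'a set" assume A: "range A \<subseteq> sets M" "decseq A" "(\<Inter>i. A i) = {}"
    have "(\<lambda>i. measure M (A i)) \<longlonglongrightarrow> 0"
      using finite_Lim_measure_decseq[OF A(1,2)] A(3) by simp
    then have "(\<lambda>i. m (A i)) \<longlonglongrightarrow> 0"
      by (rule tendsto_sandwich[rotated 2, OF tendsto_const]) (use A m0 m1 in auto)
    then show "(\<lambda>i. ennreal (m (A i))) \<longlonglongrightarrow> 0"
      using tendsto_ennrealI by fastforce
  qed auto
  have eN: "emeasure N A = ennreal (m A)" if "A \<in> sets M" for A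
    unfolding N_def by (rule emeasure_measure_of_sigma) (use pos cadd that sets.sigma_algebra_axioms in auto)
  then have "measure N A = m A" if "A \<in> sets M" for A
    using that m0[OF that] by (simp add: measure_def)
  then show ?thesis
    using sN eN m m1 by (intro exI[of _ N]) (simp add: emeasure_eq_measure)
qed

text \<open>For indicators the limit is given by the density of \<open>N\<close>. It extends to
  integrable \<open>u\<close> because multiplication by a function with values between 0 and 1 does
  not increase the L1 norm.\<close>

lemma ultrafilter_weak_star_limit_finite:
  fixes w :: "'i \<Rightarrow> 'a \<Rightarrow> real"
  assumes F: "is_ultrafilter F" and M: "finite_measure M"
    and w: "\<And>i. w i \<in> borel_measurable M" and w01: "\<And>i x. 0 \<le> w i x \<and> w i x \<le> 1"
  shows "\<exists>W\<in>borel_measurable M. (\<forall>x. 0 \<le> W x \<and> W x \<le> 1) \<and>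
    (\<forall>u. integrable M u \<longrightarrow> ((\<lambda>i. LINT x|M. w i x * u x) \<longlongrightarrow> (LINT x|M. W x * u x)) F)"
proof -
  interpret finite_measure M by fact
  note w[measurable]
  have nb: "F \<noteq> bot" using F by (simp add: is_ultrafilter_def)
  obtain N where sN: "sets N = sets M" and NM: "\<And>A. A \<in> sets M \<Longrightarrow> emeasure N A \<le> emeasure M A"
    and lim: "\<And>A. A \<in> sets M \<Longrightarrow> ((\<lambda>i. LINT x|M. w i x * indicator A x) \<longlongrightarrow> measure N A) F"
    using ultrafilter_set_limit_measure[OF F M, where w=w, OF w w01] by blast
  have spN: "space N = space M" using sN by (rule sets_eq_imp_space_eq)
  have finN: "finite_measure N"
  proof
    have "emeasure N (space N) \<le> emeasure M (space M)" using NM spN by simp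
    then show "emeasure N (space N) \<noteq> \<infinity>"
      using emeasure_finite[of "space M"] by (auto simp: top_unique)
  qed
  have ac: "absolutely_continuous M N"
    unfolding absolutely_continuous_def
  proof
    fix A assume A: "A \<in> null_sets M"
    then have "A \<in> sets M" "emeasure M A = 0" by auto
    then have "emeasure N A = 0" using NM[of A] by simp
    then show "A \<in> null_sets N" using A sN by auto
  qed
  obtain f where f[measurable]: "f \<in> borel_measurable M" and df: "density M f = N"
    using Radon_Nikodym_finite_measure[OF finN sN ac] by (elim bexE)
  have iN: "(\<integral>\<^sup>+x. f x \<partial>M) = emeasure N (space M)"
    unfolding df[symmetric] by (simp add: emeasure_density cong: nn_integral_cong)
  then have "(\<integral>\<^sup>+x. f x \<partial>M) \<noteq> \<infinity>"
    using NM[of "space M"] emeasure_finite[of "space M"] by (auto simp: top_unique)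
  then have fin: "AE x in M. f x \<noteq> \<infinity>" by (rule nn_integral_PInf_AE[OF f])
  define V where "V x = enn2real (f x)" for x
  have V[measurable]: "V \<in> borel_measurable M" unfolding V_def by measurable
  have V0: "0 \<le> V x" for x by (simp add: V_def)
  have fV: "AE x in M. f x = ennreal (V x)" using fin by eventually_elim (simp add: V_def less_top)
  have intV: "integrable M V"
  proof (rule integrableI_nonneg[OF V])
    show "AE x in M. 0 \<le> V x" using V0 by simp
    have "(\<integral>\<^sup>+x. ennreal (V x) \<partial>M) = (\<integral>\<^sup>+x. f x \<partial>M)"
      by (rule nn_integral_cong_AE) (use fV in auto)
    then show "(\<integral>\<^sup>+x. ennreal (V x) \<partial>M) < \<infinity>" using \<open>(\<integral>\<^sup>+x. f x \<partial>M) \<noteq> \<infinity>\<close> by (simp add: less_top)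
  qed
  have mN: "measure N A = (LINT x|M. V x * indicator A x)" if [measurable]: "A \<in> sets M" for A
  proof -
    have i: "integrable M (\<lambda>x. V x * indicator A x)"
      using integrable_mult_indicator[OF that intV] by (simp add: mult.commute)
    have "emeasure N A = (\<integral>\<^sup>+x. f x * indicator A x \<partial>M)" using that unfolding df[symmetric] by (simp add: emeasure_density)
    also have "\<dots> = (\<integral>\<^sup>+x. ennreal (V x * indicator A x) \<partial>M)"
      by (rule nn_integral_cong_AE) (use fV in \<open>auto simp: indicator_def\<close>)
    also have "\<dots> = ennreal (LINT x|M. V x * indicator A x)"
      by (rule nn_integral_eq_integral[OF i]) (use V0 in auto)
    finally show ?thesis using V0 by (simp add: measure_def)
  qed
  \<comment> \<open>On \<open>B\<close>, where \<open>V > 1\<close>, the positive function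
    \<open>V - 1\<close> has integral \<open>measure N B - measure M B\<close>, which is at most 0;
    so \<open>B\<close> is a null set.\<close>
  have V1: "AE x in M. V x \<le> 1"
  proof -
    define B where "B = {x \<in> space M. V x > 1}"
    have B[measurable]: "B \<in> sets M" unfolding B_def by measurable
    have i: "integrable M (\<lambda>x. V x * indicator B x)" "integrable M (\<lambda>x. indicator B x :: real)"
      using integrable_mult_indicator[OF B intV] integrable_real_indicator[OF B]
      by (auto simp: mult.commute less_top[symmetric])
    have "(LINT x|M. V x * indicator B x - indicator B x) = measure N B - measure M B"
      using i mN[OF B] by simp
    also have "\<dots> \<le> 0"
      using enn2real_mono[OF NM[OF B]] emeasure_finite[of B] by (simp add: measure_def less_top[symmetric])
    finally have "(LINT x|M. V x * indicator B x - indicator B x) \<le> 0" .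
    moreover have nn: "0 \<le> V x * indicator B x - indicator B x" for x by (auto simp: B_def indicator_def)
    moreover have "0 \<le> (LINT x|M. V x * indicator B x - indicator B x)"
      by (rule integral_nonneg_AE) (use nn in simp)
    ultimately have "(LINT x|M. V x * indicator B x - indicator B x) = 0" by linarith
    then have "AE x in M. V x * indicator B x - indicator B x = 0"
      using integral_nonneg_eq_0_iff_AE[of M "\<lambda>x. V x * indicator B x - indicator B x"] i nn by simp
    then show ?thesis using AE_space
      by eventually_elim (auto simp: B_def indicator_def split: if_splits)
  qed
  \<comment> \<open>The truncation changes \<open>V\<close> only on a null set and makes the bounds
    hold at every point.\<close>
  define W where "W x = min 1 (V x)" for x
  have W[measurable]: "W \<in> borel_measurable M" unfolding W_def by measurable
  have W01: "0 \<le> W x \<and> W x \<le> 1" for x using V0[of x] by (simp add: W_def)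
  have VW: "AE x in M. V x = W x" using V1 by eventually_elim (simp add: W_def)
  have bint: "integrable M (\<lambda>x. h x * u x)" "\<bar>LINT x|M. h x * u x\<bar> \<le> (LINT x|M. \<bar>u x\<bar>)"
    if u: "integrable M u" and [measurable]: "h \<in> borel_measurable M" and h: "\<And>x. 0 \<le> h x \<and> h x \<le> 1"
    for h u :: "'a \<Rightarrow> real"
  proof -
    have [measurable]: "u \<in> borel_measurable M" using u by auto
    have le: "\<bar>h x * u x\<bar> \<le> \<bar>u x\<bar>" for x
      using h[of x] by (simp add: abs_mult mult_left_le_one_le)
    show i: "integrable M (\<lambda>x. h x * u x)"
      by (rule Bochner_Integration.integrable_bound[OF u]) (use le in auto)
    have "\<bar>LINT x|M. h x * u x\<bar> \<le> (LINT x|M. \<bar>h x * u x\<bar>)" by (rule integral_abs_bound)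
    also have "\<dots> \<le> (LINT x|M. \<bar>u x\<bar>)"
      by (rule integral_mono) (use i u le in auto)
    finally show "\<bar>LINT x|M. h x * u x\<bar> \<le> (LINT x|M. \<bar>u x\<bar>)" .
  qed
  have "((\<lambda>i. LINT x|M. w i x * u x) \<longlongrightarrow> (LINT x|M. W x * u x)) F" if "integrable M u" for u
    using that
  proof (induction u rule: integrable_induct)
    case (base A c)
    have "(LINT x|M. W x * indicator A x) = measure N A"
      unfolding mN[OF base(1)] by (rule integral_cong_AE) (use VW base in auto)
    then show ?case using tendsto_mult_right[OF lim[OF base(1)], of c]
      by (simp add: mult.assoc[symmetric])
  next
    case (add f g)
    then show ?case
      using tendsto_add[OF add.IH] bint(1)[OF add.hyps(1)] bint(1)[OF add.hyps(2)] w w01 W W01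
      by (simp add: distrib_left)
  next
    case (lim f s)
    \<comment> \<open>The induction rule supplies approximants with
      \<open>\<bar>s n x\<bar> \<le> 2 * \<bar>f x\<bar>\<close>; hence the factor 3 in the
      dominating function.\<close>
    have L1: "(\<lambda>n. LINT x|M. \<bar>s n x - f x\<bar>) \<longlonglongrightarrow> (LINT x|M. 0)"
    proof (rule integral_dominated_convergence[where w="\<lambda>x. 3 * \<bar>f x\<bar>"])
      show "AE x in M. (\<lambda>n. \<bar>s n x - f x\<bar>) \<longlonglongrightarrow> 0"
        using lim.hyps(2) by (auto intro!: AE_I2 tendsto_rabs_zero simp: LIM_zero_iff)
      show "AE x in M. norm \<bar>s n x - f x\<bar> \<le> 3 * \<bar>f x\<bar>" for n
        using lim.hyps(3)[of _ n] by (auto intro!: AE_I2) (smt (verit, best))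
    qed (use lim.hyps(1,4) in auto)
    show ?case
    proof (rule tendstoI)
      fix d :: real assume d: "d > 0"
      have "eventually (\<lambda>n. (LINT x|M. \<bar>s n x - f x\<bar>) < d / 3) sequentially"
        by (rule order_tendstoD(2)[OF L1]) (use d in simp)
      then obtain n where n: "(LINT x|M. \<bar>s n x - f x\<bar>) < d / 3"
        by (auto simp: eventually_sequentially)
      \<comment> \<open>The error depends on \<open>s n - f\<close> but not on the multiplier
        \<open>h\<close>, so one \<open>n\<close> serves \<open>W\<close> and all \<open>w i\<close>
        at once.\<close>
      have diff: "\<bar>(LINT x|M. h x * s n x) - (LINT x|M. h x * f x)\<bar> < d / 3"
        if h: "h \<in> borel_measurable M" "\<And>x. 0 \<le> h x \<and> h x \<le> 1" for h
      proof -
        have "(LINT x|M. h x * s n x) - (LINT x|M. h x * f x) = (LINT x|M. h x * (s n x - f x))"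
          using bint(1)[OF lim.hyps(1) h] bint(1)[OF lim.hyps(4) h] by (simp add: right_diff_distrib)
        then show ?thesis using bint(2)[OF _ h, of "\<lambda>x. s n x - f x"] lim.hyps(1,4) n by fastforce
      qed
      have "eventually (\<lambda>i. dist (LINT x|M. w i x * s n x) (LINT x|M. W x * s n x) < d / 3) F"
        by (rule tendstoD[OF lim.IH[of n]]) (use d in simp)
      then show "eventually (\<lambda>i. dist (LINT x|M. w i x * f x) (LINT x|M. W x * f x) < d) F"
      proof (rule eventually_mono)
        fix i assume "dist (LINT x|M. w i x * s n x) (LINT x|M. W x * s n x) < d / 3"
        then show "dist (LINT x|M. w i x * f x) (LINT x|M. W x * f x) < d"
          using diff[OF W W01] diff[OF w[of i] w01] unfolding dist_real_def by linarith
      qed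
    qed
  qed
  then show ?thesis using W W01 by blast
qed

text \<open>A strictly positive integrable \<open>h\<close> makes \<open>density M h\<close> finite.
  Replacing \<open>u\<close> by \<open>u / h\<close> preserves integrability and all the integrals,
  so the finite case applies.\<close>

lemma ultrafilter_weak_star_limit:
  fixes w :: "'i \<Rightarrow> 'a \<Rightarrow> real"
  assumes F: "is_ultrafilter F" and M: "sigma_finite_measure M"
    and w: "\<And>i. w i \<in> borel_measurable M" and w01: "\<And>i x. 0 \<le> w i x \<and> w i x \<le> 1"
  shows "\<exists>W\<in>borel_measurable M. (\<forall>x. 0 \<le> W x \<and> W x \<le> 1) \<and>
    (\<forall>u. integrable M u \<longrightarrow> ((\<lambda>i. LINT x|M. w i x * u x) \<longlongrightarrow> (LINT x|M. W x * u x)) F)"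
proof -
  interpret sigma_finite_measure M by fact
  obtain h :: "'a \<Rightarrow> real" where h[measurable]: "h \<in> borel_measurable M" and hp: "\<And>x. 0 < h x" and hi: "integrable M h"
    using obtain_positive_integrable_function by blast
  let ?M = "density M h"
  have hnn: "AE x in M. 0 \<le> h x" using hp by (auto intro!: AE_I2 less_imp_le)
  have fin: "finite_measure ?M"
  proof
    have "emeasure ?M (space ?M) = (\<integral>\<^sup>+x. ennreal (h x) \<partial>M)"
      by (simp add: emeasure_density cong: nn_integral_cong)
    also have "\<dots> = ennreal (LINT x|M. h x)" by (rule nn_integral_eq_integral[OF hi hnn])
    finally show "emeasure ?M (space ?M) \<noteq> \<infinity>" by simp
  qed
  obtain W where W: "W \<in> borel_measurable ?M" and W01: "\<And>x. 0 \<le> W x \<and> W x \<le> 1"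
    and lim: "\<And>u. integrable ?M u \<Longrightarrow> ((\<lambda>i. LINT x|?M. w i x * u x) \<longlongrightarrow> (LINT x|?M. W x * u x)) F"
    using ultrafilter_weak_star_limit_finite[OF F fin, where w=w] w w01 by (auto simp: measurable_def)
  have W': "W \<in> borel_measurable M" using W by simp
  note [measurable] = w W'
  have "((\<lambda>i. LINT x|M. w i x * u x) \<longlongrightarrow> (LINT x|M. W x * u x)) F" if u: "integrable M u" for u
  proof -
    have [measurable]: "u \<in> borel_measurable M" using u by auto
    have hne: "h x \<noteq> 0" for x using hp[of x] by simp
    have "integrable ?M (\<lambda>x. u x / h x)"
      using u by (subst integrable_density) (auto simp: hnn hne)
    moreover have "(LINT x|?M. g x * (u x / h x)) = (LINT x|M. g x * u x)"
      if [measurable]: "g \<in> borel_measurable M" for g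
      by (subst integral_density) (auto simp: hnn hne)
    ultimately show ?thesis using lim[of "\<lambda>x. u x / h x"] w W' by simp
  qed
  then show ?thesis using W' W01 by blast
qed

section \<open>Stieltjes measures of monotone functions on the rationals\<close>

text \<open>Only the values of \<open>G\<close> at rationals are monotone. The infimum over
  rationals strictly beyond \<open>y\<close> is the right-continuous regularization that
  \<open>interval_measure\<close> asks for; it may differ from \<open>G\<close> even at
  rationals.\<close>

definition rat_right_limit :: "(real \<Rightarrow> real) \<Rightarrow> real \<Rightarrow> real" where
  "rat_right_limit G y = Inf (G ` {q\<in>\<rat>. y < q})"

text \<open>The last two claims interleave \<open>G\<close> with its regularization: at rationals
  \<open>q < r\<close>, \<open>G q \<le> rat_right_limit G q \<le> G r\<close>. This is what bounds
  the jumps between the two functions.\<close>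

lemma rat_right_limit:
  fixes G :: "real \<Rightarrow> real"
  assumes mono: "mono_on \<rat> G"
    and b: "\<And>q. 0 \<le> G q \<and> G q \<le> 1"
  shows mono_rat_right_limit: "mono (rat_right_limit G)"
    and continuous_rat_right_limit: "continuous (at_right y) (rat_right_limit G)"
    and rat_right_limit_bounds: "0 \<le> rat_right_limit G y \<and> rat_right_limit G y \<le> 1"
    and le_rat_right_limit: "q \<in> \<rat> \<Longrightarrow> G q \<le> rat_right_limit G q"
    and rat_right_limit_le: "q \<in> \<rat> \<Longrightarrow> y < q \<Longrightarrow> rat_right_limit G y \<le> G q"
proof -
  define R where "R = rat_right_limit G"
  note R_def' = R_def rat_right_limit_def
  have ne: "{q\<in>\<rat>. y < q} \<noteq> {}" for y :: real
    using Rats_dense_in_real[of y "y+1"] by auto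
  have bb: "bdd_below (G ` A)" for A using b by (auto intro!: bdd_belowI[of _ 0])
  have lower: "R y \<le> G q" if "q \<in> \<rat>" "y < q" for y q
    unfolding R_def' by (rule cInf_lower[OF _ bb]) (use that in auto)
  have greatest: "z \<le> R y" if "\<And>q. q \<in> \<rat> \<Longrightarrow> y < q \<Longrightarrow> z \<le> G q" for z y
    unfolding R_def' by (rule cInf_greatest) (use ne that in auto)
  have le: "G q \<le> R q" if "q \<in> \<rat>" for q using mono_onD[OF mono] that by (intro greatest) auto
  have bds: "0 \<le> R y \<and> R y \<le> 1" for y
  proof -
    obtain q where "q \<in> \<rat>" "y < q" using ne[of y] by blast
    then have "R y \<le> 1" using lower[of q y] b[of q] by linarith
    moreover have "0 \<le> R y" by (rule greatest) (use b in auto)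
    ultimately show ?thesis by simp
  qed
  have m: "mono R"
  proof (rule monoI)
    fix x y :: real assume "x \<le> y"
    then show "R x \<le> R y" by (intro greatest lower) simp_all
  qed
  have "continuous (at_right y) R" for y
    unfolding continuous_within
  proof (rule tendstoI)
    fix d :: real assume d: "d > 0"
    have "\<exists>q. q \<in> \<rat> \<and> y < q \<and> G q < R y + d"
    proof (rule ccontr)
      assume "\<not> ?thesis"
      then have "R y + d \<le> R y" by (intro greatest) (meson not_less)
      then show False using d by simp
    qed
    then obtain q where q: "q \<in> \<rat>" "y < q" "G q < R y + d" by blast
    have "eventually (\<lambda>x. y < x \<and> x < q) (at_right y)"
      using q(2) eventually_at_right_field by blast
    then show "eventually (\<lambda>x. dist (R x) (R y) < d) (at_right y)"
    proof (rule eventually_mono)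
      fix x assume x: "y < x \<and> x < q"
      have "R y \<le> R x" using monoD[OF m] x by simp
      moreover have "R x \<le> G q" by (rule lower) (use q x in auto)
      ultimately show "dist (R x) (R y) < d" using q(3) by (simp add: dist_real_def)
    qed
  qed
  then show "continuous (at_right y) (rat_right_limit G)" by (simp add: R_def)
  show "mono (rat_right_limit G)" using m by (simp add: R_def)
  show "0 \<le> rat_right_limit G y \<and> rat_right_limit G y \<le> 1" using bds by (simp add: R_def)
  show "G q \<le> rat_right_limit G q" if "q \<in> \<rat>" using le[OF that] by (simp add: R_def)
  show "rat_right_limit G y \<le> G q" if "q \<in> \<rat>" "y < q" using lower[OF that] by (simp add: R_def)
qed

section \<open>Abel summation and dyadic step functions\<close>

lemma sum_by_parts:
  fixes a d :: "nat \<Rightarrow> real"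
  shows "(\<Sum>j<m. a j * (d (Suc j) - d j)) = a m * d m - a 0 * d 0 - (\<Sum>j<m. (a (Suc j) - a j) * d (Suc j))"
  by (induction m) (simp_all add: algebra_simps)

text \<open>The partition points \<open>grid_pt n 0 = - 2 ^ n, \<dots>, grid_pt n (grid_len n) = 2 ^ n\<close> have mesh \<open>1 / 2 ^ n\<close>.\<close>
definition grid_pt :: "nat \<Rightarrow> nat \<Rightarrow> real" where
  "grid_pt n j = real j / 2 ^ n - 2 ^ n"

text \<open>An interval of length \<open>2 * 2 ^ n\<close> cut at mesh \<open>1 / 2 ^ n\<close> has
  \<open>2 * 4 ^ n\<close> cells.\<close>

definition grid_len :: "nat \<Rightarrow> nat" where
  "grid_len n = 2 * 4 ^ n"

text \<open>On each half-open cell this is the value of \<open>\<Psi>\<close> at the left end. The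
  differences of half-line indicators are left unevaluated because weak limits are available exactly
  for half-lines.\<close>

definition step_approx :: "nat \<Rightarrow> (real \<Rightarrow> real) \<Rightarrow> real \<Rightarrow> real" where
  "step_approx n \<Psi> y = (\<Sum>j<grid_len n. \<Psi> (grid_pt n j) *
     (indicator {..grid_pt n (Suc j)} y - indicator {..grid_pt n j} y))"

lemma grid_pt_Rats: "grid_pt n j \<in> \<rat>"
  unfolding grid_pt_def by (intro Rats_diff Rats_divide) auto

lemma grid_pt_Suc: "grid_pt n (Suc j) = grid_pt n j + 1 / 2 ^ n"
  by (simp add: grid_pt_def add_divide_distrib)

lemma grid_pt_mono: "i \<le> j \<Longrightarrow> grid_pt n i \<le> grid_pt n j"
  by (simp add: grid_pt_def divide_right_mono)

lemma grid_pt_ends: "grid_pt n 0 = - (2 ^ n)" "grid_pt n (grid_len n) = 2 ^ n"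
proof -
  show "grid_pt n 0 = - (2 ^ n)" by (simp add: grid_pt_def)
  have "(4::real) ^ n = 2 ^ n * 2 ^ n" by (simp flip: power_mult_distrib)
  then show "grid_pt n (grid_len n) = 2 ^ n" by (simp add: grid_pt_def grid_len_def)
qed

lemma step_approx_value:
  assumes "j < grid_len n" "grid_pt n j < y" "y \<le> grid_pt n (Suc j)"
  shows "step_approx n \<Psi> y = \<Psi> (grid_pt n j)"
proof -
  have "step_approx n \<Psi> y = (\<Sum>i<grid_len n. if i = j then \<Psi> (grid_pt n j) else 0)"
    unfolding step_approx_def
  proof (rule sum.cong[OF refl])
    fix i
    have "i < j \<Longrightarrow> grid_pt n (Suc i) < y" using grid_pt_mono[of "Suc i" j n] assms(2) by simp
    moreover have "j < i \<Longrightarrow> y \<le> grid_pt n i" using grid_pt_mono[of "Suc j" i n] assms(3) by simp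
    moreover have "grid_pt n i \<le> grid_pt n (Suc i)" by (rule grid_pt_mono) simp
    ultimately show "\<Psi> (grid_pt n i) * (indicator {..grid_pt n (Suc i)} y - indicator {..grid_pt n i} y) =
        (if i = j then \<Psi> (grid_pt n j) else 0)"
      using assms by (cases i j rule: linorder_cases) (auto simp: indicator_def)
  qed
  also have "\<dots> = \<Psi> (grid_pt n j)" using assms(1) by simp
  finally show ?thesis .
qed

lemma step_approx_outside:
  assumes "y \<le> - (2 ^ n) \<or> 2 ^ n < y"
  shows "step_approx n \<Psi> y = 0"
  unfolding step_approx_def
proof (rule sum.neutral, rule ballI)
  fix i assume "i \<in> {..<grid_len n}"
  then have "grid_pt n 0 \<le> grid_pt n i" "grid_pt n (Suc i) \<le> grid_pt n (grid_len n)" "grid_pt n i \<le> grid_pt n (Suc i)"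
    by (auto intro!: grid_pt_mono)
  then show "\<Psi> (grid_pt n i) * (indicator {..grid_pt n (Suc i)} y - indicator {..grid_pt n i} y) = 0"
    using assms by (auto simp: indicator_def grid_pt_ends)
qed

lemma step_approx_inside:
  assumes "- (2 ^ n) < y" "y \<le> 2 ^ n"
  shows "\<exists>j<grid_len n. grid_pt n j < y \<and> y \<le> grid_pt n (Suc j)"
proof -
  \<comment> \<open>The least index whose point reaches \<open>y\<close> is positive, since
    \<open>y\<close> exceeds the left end; its predecessor labels the cell.\<close>
  define k where "k = (LEAST k. y \<le> grid_pt n k)"
  have ex: "y \<le> grid_pt n (grid_len n)" using assms grid_pt_ends by simp
  have k: "y \<le> grid_pt n k" unfolding k_def by (rule LeastI[of "\<lambda>k. y \<le> grid_pt n k", OF ex])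
  have "k \<noteq> 0" using k assms grid_pt_ends(1)[of n] by (intro notI) simp
  then obtain j where j: "k = Suc j" by (cases k) auto
  have "k \<le> grid_len n" unfolding k_def by (rule Least_le[of "\<lambda>k. y \<le> grid_pt n k", OF ex])
  moreover have "\<not> y \<le> grid_pt n j"
    using not_less_Least[of j "\<lambda>k. y \<le> grid_pt n k"] j unfolding k_def by simp
  ultimately show ?thesis using k j by (intro exI[of _ j]) simp
qed

lemma bounded_range_abs_le:
  fixes \<Psi> :: "real \<Rightarrow> real"
  assumes "bounded (range \<Psi>)"
  obtains C where "C > 0" "\<And>y. \<bar>\<Psi> y\<bar> \<le> C"
  using assms unfolding bounded_pos by auto

lemma vanishing_tail:
  fixes \<Psi> :: "real \<Rightarrow> real"
  assumes "(\<Psi> \<longlongrightarrow> 0) at_infinity" "d > 0"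
  obtains R where "R > 0" "\<And>y. R \<le> \<bar>y\<bar> \<Longrightarrow> \<bar>\<Psi> y\<bar> < d"
proof -
  have "eventually (\<lambda>y. \<bar>\<Psi> y\<bar> < d) at_infinity"
    using tendstoD[OF assms] by (simp add: dist_real_def)
  then obtain b where "\<And>y. b \<le> \<bar>y\<bar> \<Longrightarrow> \<bar>\<Psi> y\<bar> < d" unfolding eventually_at_infinity by auto
  then show thesis by (intro that[of "max b 1"]) auto
qed

lemma vanishing_uniformly_continuous:
  fixes \<Psi> :: "real \<Rightarrow> real"
  assumes c: "continuous_on UNIV \<Psi>" and t: "(\<Psi> \<longlongrightarrow> 0) at_infinity"
  shows "uniformly_continuous_on UNIV \<Psi>"
  unfolding uniformly_continuous_on_def
proof (intro allI impI)
  fix d :: real assume d: "d > 0"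
  obtain R where R: "R > 0" "\<And>y. R \<le> \<bar>y\<bar> \<Longrightarrow> \<bar>\<Psi> y\<bar> < d / 2"
    using vanishing_tail[OF t, of "d/2"] d by auto
  \<comment> \<open>The margin 1 ensures that two points at distance below 1, one of them in
    \<open>{-R..R}\<close>, both lie in the interval.\<close>
  have "uniformly_continuous_on {-(R+1)..R+1} \<Psi>"
    by (rule compact_uniformly_continuous) (use c continuous_on_subset in auto)
  then obtain e where e: "e > 0" "\<And>x y. x \<in> {-(R+1)..R+1} \<Longrightarrow> y \<in> {-(R+1)..R+1} \<Longrightarrow> dist y x < e \<Longrightarrow> dist (\<Psi> y) (\<Psi> x) < d"
    using d unfolding uniformly_continuous_on_def by metis
  have "dist (\<Psi> y) (\<Psi> x) < d" if "dist y x < min e 1" for x y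
  proof (cases "\<bar>x\<bar> \<le> R \<or> \<bar>y\<bar> \<le> R")
    case True
    then show ?thesis using that by (intro e) (auto simp: dist_real_def)
  next
    case False
    then have "\<bar>\<Psi> x\<bar> < d / 2" "\<bar>\<Psi> y\<bar> < d / 2" using R(2)[of x] R(2)[of y] by auto
    then show ?thesis unfolding dist_real_def by linarith
  qed
  then show "\<exists>e>0. \<forall>x\<in>UNIV. \<forall>y\<in>UNIV. dist y x < e \<longrightarrow> dist (\<Psi> y) (\<Psi> x) < d"
    using e(1) by (intro exI[of _ "min e 1"]) auto
qed

text \<open>The first estimate is the approximation itself. Smallness at both ends and of
  consecutive differences controls the boundary terms and the remaining sum in the later summation
  by parts.\<close>

lemma step_approx_uniform:
  fixes \<Psi> :: "real \<Rightarrow> real"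
  assumes c: "continuous_on UNIV \<Psi>" and t: "(\<Psi> \<longlongrightarrow> 0) at_infinity" and d: "d > 0"
  shows "eventually (\<lambda>n. (\<forall>y. \<bar>step_approx n \<Psi> y - \<Psi> y\<bar> < d) \<and> \<bar>\<Psi> (2 ^ n)\<bar> < d \<and> \<bar>\<Psi> (- (2 ^ n))\<bar> < d \<and>
     (\<forall>j. \<bar>\<Psi> (grid_pt n (Suc j)) - \<Psi> (grid_pt n j)\<bar> < d)) sequentially"
proof -
  obtain R where R: "R > 0" "\<And>y. R \<le> \<bar>y\<bar> \<Longrightarrow> \<bar>\<Psi> y\<bar> < d" using vanishing_tail[OF t d] by auto
  obtain e where e: "e > 0" "\<And>x y. dist y x < e \<Longrightarrow> dist (\<Psi> y) (\<Psi> x) < d"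
    using vanishing_uniformly_continuous[OF c t] d unfolding uniformly_continuous_on_def by (metis UNIV_I)
  have l1: "filterlim (\<lambda>n. 2 ^ n :: real) at_top sequentially"
    by (rule filterlim_at_infinity_imp_filterlim_at_top[OF filterlim_realpow_sequentially_gt1]) simp_all
  have l2: "(\<lambda>n. 1 / 2 ^ n :: real) \<longlonglongrightarrow> 0" using LIMSEQ_divide_realpow_zero[of 2 1] by simp
  have "eventually (\<lambda>n. R \<le> 2 ^ n) sequentially" using l1 by (simp add: filterlim_at_top)
  moreover have "eventually (\<lambda>n. 1 / 2 ^ n < e) sequentially" using order_tendstoD(2)[OF l2 e(1)] .
  ultimately show ?thesis
  proof eventually_elim
    case (elim n)
    have "\<bar>step_approx n \<Psi> y - \<Psi> y\<bar> < d" for y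
    proof (cases "- (2 ^ n) < y \<and> y \<le> 2 ^ n")
      case True
      then obtain j where j: "j < grid_len n" "grid_pt n j < y" "y \<le> grid_pt n (Suc j)"
        using step_approx_inside[of n y] by auto
      then have "dist (grid_pt n j) y < e" using elim(2) unfolding grid_pt_Suc by (simp add: dist_real_def)
      then show ?thesis using e(2) step_approx_value[OF j] by (simp add: dist_real_def)
    next
      case False
      then have "step_approx n \<Psi> y = 0" by (intro step_approx_outside) auto
      then show ?thesis using R(2)[of y] False elim(1) by auto
    qed
    moreover have "\<bar>\<Psi> (grid_pt n (Suc j)) - \<Psi> (grid_pt n j)\<bar> < d" for j
      using e(2)[of "grid_pt n (Suc j)" "grid_pt n j"] elim(2) unfolding grid_pt_Suc by (simp add: dist_real_def)
    moreover have "\<bar>\<Psi> (2 ^ n)\<bar> < d" "\<bar>\<Psi> (- (2 ^ n))\<bar> < d" using R(2)[of "2 ^ n"] R(2)[of "- (2 ^ n)"] elim(1) by auto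
    ultimately show ?case by blast
  qed
qed

text \<open>The integral is described through sums in \<open>G\<close>, not in its regularization,
  because the weak limits give information about \<open>G\<close> at rational points only. The same
  sums later show measurability of the integral in \<open>x\<close>.\<close>

lemma stieltjes_measure_exists:
  fixes G :: "real \<Rightarrow> real"
  assumes mono: "mono_on \<rat> G"
    and b: "\<And>q. 0 \<le> G q \<and> G q \<le> 1"
  shows "\<exists>M. sets M = sets borel \<and> emeasure M UNIV \<le> 1 \<and>
    (\<forall>\<Psi>. continuous_on UNIV \<Psi> \<longrightarrow> bounded (range \<Psi>) \<longrightarrow> (\<Psi> \<longlongrightarrow> 0) at_infinity \<longrightarrow>
      (\<lambda>n. \<Sum>j<grid_len n. \<Psi> (grid_pt n j) * (G (grid_pt n (Suc j)) - G (grid_pt n j)))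
        \<longlonglongrightarrow> (LINT y|M. \<Psi> y))"
proof -
  define R where "R = rat_right_limit G"
  note Rf = rat_right_limit[of G, OF mono b, folded R_def]
  have Rm: "x \<le> y \<Longrightarrow> R x \<le> R y" for x y using monoD[OF Rf(1)] by simp
  define M where "M = interval_measure R"
  have sM: "sets M = sets borel" and spM: "space M = UNIV" by (auto simp: M_def)
  have eIoc: "emeasure M {x<..y} = ennreal (R y - R x)" if "x \<le> y" for x y
    unfolding M_def using that Rm Rf(2) by (rule emeasure_interval_measure_Ioc)
  have le1: "emeasure M UNIV \<le> 1"
  proof -
    have U: "(\<Union>n::nat. {- real n<..real n}) = UNIV"
    proof (rule UNIV_eq_I[symmetric])
      fix y :: real
      obtain n :: nat where "\<bar>y\<bar> < real n" using reals_Archimedean2 by blast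
      then have "y \<in> {- real n<..real n}" by auto
      then show "y \<in> (\<Union>n::nat. {- real n<..real n})" by blast
    qed
    have "(SUP n. emeasure M {- real n<..real n}) = emeasure M (\<Union>n::nat. {- real n<..real n})"
      by (rule SUP_emeasure_incseq) (auto simp: sM incseq_def)
    then have "emeasure M UNIV = (SUP n. emeasure M {- real n<..real n})" unfolding U by simp
    also have "\<dots> \<le> 1"
    proof (rule SUP_least)
      fix n :: nat
      have "R (real n) - R (- real n) \<le> 1" using Rf(3)[of "real n"] Rf(3)[of "- real n"] by linarith
      then show "emeasure M {- real n<..real n} \<le> 1" by (simp add: eIoc)
    qed
    finally show ?thesis .
  qed
  interpret finite_measure M
  proof
    show "emeasure M (space M) \<noteq> \<infinity>" using le1 spM by (auto simp: top_unique)
  qed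
  have mU: "measure M UNIV \<le> 1" using le1 by (simp add: emeasure_eq_measure)
  have iic: "integrable M (indicator {..x} :: real \<Rightarrow> real)" for x
    by (rule integrable_real_indicator) (auto simp: sM less_top[symmetric])
  have intstep: "integrable M (step_approx n \<Psi>)" "(LINT y|M. step_approx n \<Psi> y) =
      (\<Sum>j<grid_len n. \<Psi> (grid_pt n j) * (R (grid_pt n (Suc j)) - R (grid_pt n j)))" for n \<Psi>
  proof -
    have *: "(LINT y|M. indicator {..grid_pt n (Suc j)} y - indicator {..grid_pt n j} y) =
        R (grid_pt n (Suc j)) - R (grid_pt n j)" for j
    proof -
      have le: "grid_pt n j \<le> grid_pt n (Suc j)" by (rule grid_pt_mono) simp
      have "(LINT y|M. indicator {..grid_pt n (Suc j)} y - indicator {..grid_pt n j} y) =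
         (LINT y|M. (indicator {grid_pt n j<..grid_pt n (Suc j)} y :: real))"
        by (rule Bochner_Integration.integral_cong) (use le in \<open>auto simp: indicator_def\<close>)
      also have "\<dots> = measure M {grid_pt n j<..grid_pt n (Suc j)}" by (simp add: sM spM)
      finally show ?thesis using eIoc[OF le] Rm[OF le] by (simp add: measure_def)
    qed
    show "integrable M (step_approx n \<Psi>)" unfolding step_approx_def
      by (intro Bochner_Integration.integrable_sum integrable_mult_right Bochner_Integration.integrable_diff iic)
    show "(LINT y|M. step_approx n \<Psi> y) =
      (\<Sum>j<grid_len n. \<Psi> (grid_pt n j) * (R (grid_pt n (Suc j)) - R (grid_pt n j)))"
      unfolding step_approx_def
      by (subst Bochner_Integration.integral_sum,
          intro integrable_mult_right Bochner_Integration.integrable_diff iic)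
        (simp only: integral_mult_right_zero *)
  qed
  have lim: "(\<lambda>n. \<Sum>j<grid_len n. \<Psi> (grid_pt n j) * (G (grid_pt n (Suc j)) - G (grid_pt n j)))
        \<longlonglongrightarrow> (LINT y|M. \<Psi> y)"
    if c: "continuous_on UNIV \<Psi>" and bd: "bounded (range \<Psi>)" and t: "(\<Psi> \<longlongrightarrow> 0) at_infinity" for \<Psi>
  proof (rule tendstoI)
    fix d :: real assume d: "d > 0"
    obtain C where C: "\<And>y. \<bar>\<Psi> y\<bar> \<le> C" using bounded_range_abs_le[OF bd] by blast
    have \<Psi>m: "\<Psi> \<in> borel_measurable M"
      using borel_measurable_continuous_onI[OF c] by (simp add: measurable_cong_sets[OF sM refl])
    have \<Psi>i: "integrable M \<Psi>" by (rule integrable_const_bound[of _ C]) (use C \<Psi>m in auto)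
    \<comment> \<open>Summation by parts costs \<open>3 * k\<close> (two boundary terms and one sum)
      and the step approximation one more \<open>k\<close>; a fifth share leaves a strict
      inequality.\<close>
    define k where "k = d / 5"
    have k: "k > 0" and dk: "d = 5 * k" using d by (auto simp: k_def)
    from step_approx_uniform[OF c t k]
    show "eventually (\<lambda>n. dist (\<Sum>j<grid_len n. \<Psi> (grid_pt n j) * (G (grid_pt n (Suc j)) - G (grid_pt n j)))
      (LINT y|M. \<Psi> y) < d) sequentially"
    proof (rule eventually_mono, elim conjE)
      fix n
      assume u: "\<forall>y. \<bar>step_approx n \<Psi> y - \<Psi> y\<bar> < k" and e1: "\<bar>\<Psi> (2 ^ n)\<bar> < k" and e0: "\<bar>\<Psi> (- (2 ^ n))\<bar> < k"
        and s: "\<forall>j. \<bar>\<Psi> (grid_pt n (Suc j)) - \<Psi> (grid_pt n j)\<bar> < k"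
      define a where "a j = \<Psi> (grid_pt n j)" for j
      \<comment> \<open>The sums for \<open>G\<close> and for its right limit \<open>R\<close> differ by \<open>\<Sum>j. a j * (D (Suc j) - D j)\<close>; summation by
        parts moves the difference onto \<open>a\<close>, and the jumps \<open>D j\<close> have total mass at most \<open>1\<close>.\<close>
      define D where "D j = R (grid_pt n j) - G (grid_pt n j)" for j
      let ?m = "grid_len n"
      have D0: "0 \<le> D j" for j using Rf(4)[OF grid_pt_Rats] by (simp add: D_def)
      \<comment> \<open>The next partition point is a rational strictly to the right, so each jump
        \<open>D j\<close> is at most the following increment of \<open>G\<close>.\<close>
      have RG: "R (grid_pt n j) \<le> G (grid_pt n (Suc j))" for j
        by (rule Rf(5)[OF grid_pt_Rats]) (simp add: grid_pt_Suc)
      have D1: "D j \<le> G (grid_pt n (Suc j)) - G (grid_pt n j)" for j using RG[of j] by (simp add: D_def)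
      have D2: "D j \<le> 1" for j using D1[of j] b[of "grid_pt n j"] b[of "grid_pt n (Suc j)"] by linarith
      \<comment> \<open>After the shift, the increments run one partition point beyond
        \<open>2 ^ n\<close>; the bounds on \<open>G\<close> hold there as well, so the telescoped
        sum is still at most 1.\<close>
      have "(\<Sum>j<?m. D (Suc j)) \<le> (\<Sum>j<?m. G (grid_pt n (Suc (Suc j))) - G (grid_pt n (Suc j)))"
        by (rule sum_mono) (rule D1)
      also have "\<dots> = G (grid_pt n (Suc ?m)) - G (grid_pt n (Suc 0))"
        by (rule sum_lessThan_telescope[of "\<lambda>j. G (grid_pt n (Suc j))"])
      also have "\<dots> \<le> 1" using b[of "grid_pt n (Suc ?m)"] b[of "grid_pt n (Suc 0)"] by linarith
      finally have sD: "(\<Sum>j<?m. D (Suc j)) \<le> 1" .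
      have "\<bar>(a (Suc j) - a j) * D (Suc j)\<bar> \<le> k * D (Suc j)" for j
        using mult_right_mono[OF less_imp_le[OF spec[OF s, of j]] D0[of "Suc j"]] D0[of "Suc j"]
        by (simp add: abs_mult a_def)
      then have "\<bar>\<Sum>j<?m. (a (Suc j) - a j) * D (Suc j)\<bar> \<le> (\<Sum>j<?m. k * D (Suc j))"
        by (intro order_trans[OF sum_abs sum_mono])
      also have "\<dots> \<le> k * 1" unfolding sum_distrib_left[symmetric] by (rule mult_left_mono) (use sD k in auto)
      finally have P1: "\<bar>\<Sum>j<?m. (a (Suc j) - a j) * D (Suc j)\<bar> \<le> k" by simp
      have P2: "\<bar>a ?m * D ?m\<bar> \<le> k" "\<bar>a 0 * D 0\<bar> \<le> k"
        using mult_mono[of "\<bar>a ?m\<bar>" k "D ?m" 1] mult_mono[of "\<bar>a 0\<bar>" k "D 0" 1] D0 D2 e0 e1 k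
        by (auto simp: abs_mult a_def grid_pt_ends)
      have "(\<Sum>j<?m. a j * (R (grid_pt n (Suc j)) - R (grid_pt n j))) -
          (\<Sum>j<?m. a j * (G (grid_pt n (Suc j)) - G (grid_pt n j))) = (\<Sum>j<?m. a j * (D (Suc j) - D j))"
        unfolding sum_subtractf[symmetric] D_def by (rule sum.cong) (auto simp: algebra_simps)
      then have "\<bar>(\<Sum>j<?m. a j * (R (grid_pt n (Suc j)) - R (grid_pt n j))) -
          (\<Sum>j<?m. a j * (G (grid_pt n (Suc j)) - G (grid_pt n j)))\<bar> \<le> 3 * k"
        unfolding sum_by_parts using P1 P2 by linarith
      moreover have "\<bar>(LINT y|M. step_approx n \<Psi> y) - (LINT y|M. \<Psi> y)\<bar> \<le> k"
      proof -
        have "\<bar>(LINT y|M. step_approx n \<Psi> y) - (LINT y|M. \<Psi> y)\<bar> = \<bar>LINT y|M. step_approx n \<Psi> y - \<Psi> y\<bar>"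
          using intstep(1) \<Psi>i by simp
        also have "\<dots> \<le> (LINT y|M. \<bar>step_approx n \<Psi> y - \<Psi> y\<bar>)" by (rule integral_abs_bound)
        also have "\<dots> \<le> (LINT y|M. k)"
          by (rule integral_mono) (use intstep(1) \<Psi>i u in \<open>auto intro: less_imp_le\<close>)
        also have "\<dots> \<le> k" using mU k spM by (simp add: mult_left_le_one_le)
        finally show ?thesis .
      qed
      ultimately show "dist (\<Sum>j<?m. \<Psi> (grid_pt n j) * (G (grid_pt n (Suc j)) - G (grid_pt n j))) (LINT y|M. \<Psi> y) < d"
        unfolding intstep(2) a_def[symmetric] dist_real_def using k dk by linarith
    qed
  qed
  show ?thesis
  proof (rule exI[of _ M], intro conjI allI impI)
    show "sets M = sets borel" "emeasure M UNIV \<le> 1" by (rule sM, rule le1)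
  qed (rule lim)
qed

section \<open>Young measures along an ultrafilter\<close>

text \<open>The assumption on \<open>T\<close> says that, at each point, \<open>T i\<close> is
  either zero or evaluation at some real number \<open>c\<close>. Hence it is linear, monotone and
  contracting for the supremum norm, which is all that the proof needs to know about step functions
  on cubes.\<close>

lemma weak_limit_kernel:
  fixes T :: "'i \<Rightarrow> (real \<Rightarrow> real) \<Rightarrow> 'a \<Rightarrow> real"
  assumes F: "is_ultrafilter F" and M: "sigma_finite_measure M"
    and T: "\<And>i z. \<exists>s c. (s = 0 \<or> s = 1) \<and> (\<forall>h. T i h z = s * h c)"
    and Tm: "\<And>i h. T i h \<in> borel_measurable M"
  shows "\<exists>\<mu> :: 'a \<Rightarrow> real measure. (\<forall>x. sets (\<mu> x) = sets borel \<and> emeasure (\<mu> x) UNIV \<le> 1) \<and>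
    (\<forall>\<Psi>\<in>C0b. (\<lambda>x. LINT y|\<mu> x. \<Psi> y) \<in> borel_measurable M \<and>
      (\<forall>u. integrable M u \<longrightarrow>
        ((\<lambda>i. LINT x|M. T i \<Psi> x * u x) \<longlongrightarrow> (LINT x|M. (LINT y|\<mu> x. \<Psi> y) * u x)) F))"
proof -
  interpret sigma_finite_measure M by fact
  note Tm[measurable]
  have nb: "F \<noteq> bot" using F by (simp add: is_ultrafilter_def)
  have Tb: "\<bar>T i h z\<bar> \<le> C" if "\<And>y. \<bar>h y\<bar> \<le> C" for i h z C
  proof -
    obtain s c where "s = 0 \<or> s = 1" "T i h z = s * h c" using T[of i z] by metis
    then show ?thesis using that[of c] by auto
  qed
  have Ti: "0 \<le> T i (indicator {..q}) x \<and> T i (indicator {..q}) x \<le> 1" for i q x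
  proof -
    obtain s c where "s = 0 \<or> s = 1" "T i (indicator {..q}) x = s * indicator {..q} c" using T[of i x] by metis
    then show ?thesis by (auto simp: indicator_def)
  qed
  have bint: "integrable M (\<lambda>x. h x * u x)" "\<bar>LINT x|M. h x * u x\<bar> \<le> C * (LINT x|M. \<bar>u x\<bar>)"
    if u: "integrable M u" and [measurable]: "h \<in> borel_measurable M" and h: "\<And>x. \<bar>h x\<bar> \<le> C"
    for h u :: "'a \<Rightarrow> real" and C
  proof -
    have [measurable]: "u \<in> borel_measurable M" using u by auto
    have C0: "0 \<le> C" using h[of undefined] by linarith
    have le: "\<bar>h x * u x\<bar> \<le> C * \<bar>u x\<bar>" for x
      unfolding abs_mult by (rule mult_right_mono[OF h]) simp
    have i': "integrable M (\<lambda>x. C * \<bar>u x\<bar>)" using u by simp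
    show i: "integrable M (\<lambda>x. h x * u x)"
      by (rule Bochner_Integration.integrable_bound[OF i']) (use le C0 in auto)
    have "\<bar>LINT x|M. h x * u x\<bar> \<le> (LINT x|M. \<bar>h x * u x\<bar>)" by (rule integral_abs_bound)
    also have "\<dots> \<le> (LINT x|M. C * \<bar>u x\<bar>)"
      by (rule integral_mono) (use i i' le in auto)
    finally show "\<bar>LINT x|M. h x * u x\<bar> \<le> C * (LINT x|M. \<bar>u x\<bar>)" by simp
  qed
  let ?P = "\<lambda>q w. w \<in> borel_measurable M \<and> ((\<forall>x. 0 \<le> w x \<and> w x \<le> 1) \<and>
    (\<forall>u. integrable M u \<longrightarrow> ((\<lambda>i. LINT x|M. T i (indicator {..q}) x * u x) \<longlongrightarrow> (LINT x|M. w x * u x)) F))"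
  define W where "W q = (SOME w. ?P q w)" for q
  have WP: "?P q (W q)" for q
    unfolding W_def
    by (rule someI_ex[where P="?P q"], rule ultrafilter_weak_star_limit[OF F M, where w="\<lambda>i. T i (indicator {..q})",
          OF Tm Ti, unfolded Bex_def])
  have W[measurable]: "W q \<in> borel_measurable M" for q using WP[of q] by simp
  have W01: "0 \<le> W q x \<and> W q x \<le> 1" for q x using WP[of q] by simp
  have Wlim: "((\<lambda>i. LINT x|M. T i (indicator {..q}) x * u x) \<longlongrightarrow> (LINT x|M. W q x * u x)) F"
    if "integrable M u" for q u
    using WP[of q] that by simp
  have Wabs: "\<bar>W q x\<bar> \<le> 1" for q x using W01[of q x] by simp
  have Tiabs: "\<bar>T i (indicator {..q}) x\<bar> \<le> 1" for i q x using Ti[of i q x] by simp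
  have Wmono: "AE x in M. W q x \<le> W r x" if "q \<le> r" for q r
  proof -
    \<comment> \<open>\<open>B\<close> may have infinite measure; weighting its indicator by a
      strictly positive integrable \<open>k\<close> makes it an admissible test function.\<close>
    obtain k :: "'a \<Rightarrow> real" where k[measurable]: "k \<in> borel_measurable M" and kp: "\<And>x. 0 < k x" and ki: "integrable M k"
      by (rule obtain_positive_integrable_function) (rule that; simp)
    define B where "B = {x \<in> space M. W r x < W q x}"
    have B[measurable]: "B \<in> sets M" unfolding B_def by measurable
    define u where "u x = indicator B x * k x" for x
    have u: "integrable M u"
      unfolding u_def using integrable_mult_indicator[OF B ki] by simp
    have u0: "0 \<le> u x" for x using kp[of x] by (simp add: u_def)
    have le: "(LINT x|M. T i (indicator {..q}) x * u x) \<le> (LINT x|M. T i (indicator {..r}) x * u x)" for i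
    proof (rule integral_mono[OF bint(1)[OF u Tm Tiabs] bint(1)[OF u Tm Tiabs]])
      fix x
      obtain s c where sc: "s = 0 \<or> s = 1" "\<And>h. T i h x = s * h c" using T[of i x] by metis
      then show "T i (indicator {..q}) x * u x \<le> T i (indicator {..r}) x * u x"
        using \<open>q \<le> r\<close> u0[of x] by (intro mult_right_mono) (auto simp: indicator_def)
    qed
    have "(LINT x|M. W q x * u x) \<le> (LINT x|M. W r x * u x)"
      by (rule tendsto_le[OF nb Wlim[OF u] Wlim[OF u]]) (use le in simp)
    then have "(LINT x|M. (W q x - W r x) * u x) \<le> 0"
      using bint(1)[OF u W Wabs, of q] bint(1)[OF u W Wabs, of r] by (simp add: left_diff_distrib)
    moreover have i: "integrable M (\<lambda>x. (W q x - W r x) * u x)"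
      using bint(1)[OF u W Wabs, of q] bint(1)[OF u W Wabs, of r] by (simp add: left_diff_distrib)
    moreover have nn: "0 \<le> (W q x - W r x) * u x" for x
      using kp[of x] by (auto simp: u_def B_def indicator_def)
    moreover have "0 \<le> (LINT x|M. (W q x - W r x) * u x)"
      by (rule integral_nonneg_AE) (use nn in simp)
    ultimately have "(LINT x|M. (W q x - W r x) * u x) = 0" by linarith
    then have "AE x in M. (W q x - W r x) * u x = 0"
      using integral_nonneg_eq_0_iff_AE[OF i] nn by simp
    then show ?thesis using AE_space
    proof eventually_elim
      case (elim x)
      show ?case
      proof (rule ccontr)
        assume "\<not> W q x \<le> W r x"
        then have "u x > 0" using elim(2) kp[of x] by (simp add: u_def B_def)
        then show False using elim(1) \<open>\<not> W q x \<le> W r x\<close> by simp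
      qed
    qed
  qed
  \<comment> \<open>Each pair \<open>q \<le> r\<close> has its own null set. Countably many rational
    pairs leave one common null set outside \<open>good\<close>.\<close>
  define good where "good = {x \<in> space M. \<forall>q\<in>\<rat>. \<forall>r\<in>\<rat>. q \<le> r \<longrightarrow> W q x \<le> W r x}"
  have cR: "countable (\<rat> :: real set)" by (rule countable_rat)
  have good[measurable]: "good \<in> sets M"
    unfolding good_def using cR by measurable
  have AEgood: "AE x in M. x \<in> good"
  proof -
    have "AE x in M. \<forall>q\<in>\<rat>. \<forall>r\<in>\<rat>. q \<le> r \<longrightarrow> W q x \<le> W r x"
      by (intro AE_ball_countable[OF cR, THEN iffD2] ballI) (use Wmono in \<open>auto intro: AE_impI\<close>)
    then show ?thesis using AE_space by eventually_elim (simp add: good_def)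
  qed
  \<comment> \<open>The default 0 outside \<open>good\<close> keeps monotonicity and the bounds
    valid for every \<open>x\<close>, so a measure exists at every point.\<close>
  define G where "G x q = (if x \<in> good then W q x else 0)" for x q
  have Gmono: "mono_on \<rat> (G x)" for x by (auto simp: G_def good_def intro!: mono_onI)
  have G01: "0 \<le> G x q \<and> G x q \<le> 1" for x q using W01 by (simp add: G_def)
  have Gm[measurable]: "(\<lambda>x. G x q) \<in> borel_measurable M" for q unfolding G_def by measurable
  have GW: "AE x in M. \<forall>q. G x q = W q x" using AEgood by eventually_elim (simp add: G_def)
  define A where "A \<Psi> n x = (\<Sum>j<grid_len n. \<Psi> (grid_pt n j) * (G x (grid_pt n (Suc j)) - G x (grid_pt n j)))"
    for \<Psi> :: "real \<Rightarrow> real" and n x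
  have "\<forall>x. \<exists>N. sets N = sets borel \<and> emeasure N UNIV \<le> 1 \<and>
    (\<forall>\<Psi>. continuous_on UNIV \<Psi> \<longrightarrow> bounded (range \<Psi>) \<longrightarrow> (\<Psi> \<longlongrightarrow> 0) at_infinity \<longrightarrow>
      (\<lambda>n. A \<Psi> n x) \<longlonglongrightarrow> (LINT y|N. \<Psi> y))"
    unfolding A_def using stieltjes_measure_exists[OF Gmono G01] by simp
  then obtain \<mu> where \<mu>: "\<And>x. sets (\<mu> x) = sets borel" "\<And>x. emeasure (\<mu> x) UNIV \<le> 1"
    and \<mu>lim: "\<And>x \<Psi>. continuous_on UNIV \<Psi> \<Longrightarrow> bounded (range \<Psi>) \<Longrightarrow> (\<Psi> \<longlongrightarrow> 0) at_infinity \<Longrightarrow>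
      (\<lambda>n. A \<Psi> n x) \<longlonglongrightarrow> (LINT y|\<mu> x. \<Psi> y)"
    by (auto dest!: choice)
  have "(\<lambda>x. LINT y|\<mu> x. \<Psi> y) \<in> borel_measurable M \<and>
      (\<forall>u. integrable M u \<longrightarrow>
        ((\<lambda>i. LINT x|M. T i \<Psi> x * u x) \<longlongrightarrow> (LINT x|M. (LINT y|\<mu> x. \<Psi> y) * u x)) F)"
    if \<Psi>: "\<Psi> \<in> C0b" for \<Psi>
  proof (intro conjI allI impI)
    have c: "continuous_on UNIV \<Psi>" and bd: "bounded (range \<Psi>)" and t: "(\<Psi> \<longlongrightarrow> 0) at_infinity"
      using \<Psi> by (auto simp: C0b_def)
    obtain C where C0: "C > 0" and C: "\<And>y. \<bar>\<Psi> y\<bar> \<le> C" using bounded_range_abs_le[OF bd] by blast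
    define L where "L x = (LINT y|\<mu> x. \<Psi> y)" for x
    have AL: "(\<lambda>n. A \<Psi> n x) \<longlonglongrightarrow> L x" for x unfolding L_def by (rule \<mu>lim[OF c bd t])
    have Am[measurable]: "A \<Psi> n \<in> borel_measurable M" for n unfolding A_def by measurable
    \<comment> \<open>The measures \<open>\<mu> x\<close> come from choice; measurability is
      recovered because the integral is a pointwise limit of finite combinations of the measurable
      \<open>G x q\<close>.\<close>
    have Lm[measurable]: "L \<in> borel_measurable M"
      by (rule borel_measurable_LIMSEQ_real[OF AL Am])
    then show "(\<lambda>x. LINT y|\<mu> x. \<Psi> y) \<in> borel_measurable M" by (simp add: L_def[abs_def])
    \<comment> \<open>The increments of \<open>G x\<close> are nonnegative and telescope to at most
      1. The bound is uniform in \<open>n\<close> and permits dominated convergence in this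
      sequential limit.\<close>
    have AC: "\<bar>A \<Psi> n x\<bar> \<le> C" for n x
    proof -
      have inc: "0 \<le> G x (grid_pt n (Suc j)) - G x (grid_pt n j)" for j
        using mono_onD[OF Gmono[of x] grid_pt_Rats[of n j] grid_pt_Rats[of n "Suc j"]] grid_pt_mono[of j "Suc j" n]
        by simp
      have "\<bar>\<Psi> (grid_pt n j) * (G x (grid_pt n (Suc j)) - G x (grid_pt n j))\<bar> \<le>
          C * (G x (grid_pt n (Suc j)) - G x (grid_pt n j))" for j
        using mult_right_mono[OF C inc] inc[of j] by (simp add: abs_mult)
      then have "\<bar>A \<Psi> n x\<bar> \<le> (\<Sum>j<grid_len n. C * (G x (grid_pt n (Suc j)) - G x (grid_pt n j)))"
        unfolding A_def by (intro order_trans[OF sum_abs sum_mono])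
      also have "\<dots> = C * (G x (grid_pt n (grid_len n)) - G x (grid_pt n 0))"
        unfolding sum_distrib_left[symmetric] by (subst sum_lessThan_telescope[of "\<lambda>j. G x (grid_pt n j)"]) simp
      also have "\<dots> \<le> C * 1"
        by (rule mult_left_mono) (use G01[of x "grid_pt n (grid_len n)"] G01[of x "grid_pt n 0"] C0 in auto)
      finally show ?thesis by simp
    qed
    fix u :: "'a \<Rightarrow> real" assume u: "integrable M u"
    note [measurable] = borel_measurable_integrable[OF u]
    define U where "U = (LINT x|M. \<bar>u x\<bar>)"
    have U0: "0 \<le> U" unfolding U_def by (rule integral_nonneg_AE) simp
    have ALint: "(\<lambda>n. LINT x|M. A \<Psi> n x * u x) \<longlonglongrightarrow> (LINT x|M. L x * u x)"
    proof (rule integral_dominated_convergence[where w="\<lambda>x. C * \<bar>u x\<bar>"])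
      show "AE x in M. (\<lambda>n. A \<Psi> n x * u x) \<longlonglongrightarrow> L x * u x" using AL by (auto intro!: AE_I2 tendsto_intros)
      show "AE x in M. norm (A \<Psi> n x * u x) \<le> C * \<bar>u x\<bar>" for n
        using AC by (auto intro!: AE_I2 mult_right_mono simp: abs_mult)
    qed (use u in auto)
    \<comment> \<open>For fixed \<open>n\<close> both sides are the same finite combination of
      half-line integrals, so the weak limits \<open>W q\<close> apply term by term.\<close>
    have Tstep: "((\<lambda>i. LINT x|M. T i (step_approx n \<Psi>) x * u x) \<longlongrightarrow> (LINT x|M. A \<Psi> n x * u x)) F" for n
    proof -
      have e1: "(LINT x|M. T i (step_approx n \<Psi>) x * u x) = (\<Sum>j<grid_len n. \<Psi> (grid_pt n j) *
        ((LINT x|M. T i (indicator {..grid_pt n (Suc j)}) x * u x) - (LINT x|M. T i (indicator {..grid_pt n j}) x * u x)))" for i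
      proof -
        have "T i (step_approx n \<Psi>) x * u x = (\<Sum>j<grid_len n. \<Psi> (grid_pt n j) *
          (T i (indicator {..grid_pt n (Suc j)}) x * u x - T i (indicator {..grid_pt n j}) x * u x))" for x
        proof -
          obtain s c where "\<And>h. T i h x = s * h c" using T[of i x] by metis
          then show ?thesis by (simp add: step_approx_def sum_distrib_left sum_distrib_right algebra_simps)
        qed
        then show ?thesis using bint(1)[OF u Tm Tiabs] by simp
      qed
      have e2: "(LINT x|M. A \<Psi> n x * u x) = (\<Sum>j<grid_len n. \<Psi> (grid_pt n j) *
        ((LINT x|M. W (grid_pt n (Suc j)) x * u x) - (LINT x|M. W (grid_pt n j) x * u x)))"
      proof -
        have "(LINT x|M. A \<Psi> n x * u x) = (LINT x|M. (\<Sum>j<grid_len n. \<Psi> (grid_pt n j) *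
          (W (grid_pt n (Suc j)) x * u x - W (grid_pt n j) x * u x)))"
        proof (rule integral_cong_AE)
          show "AE x in M. A \<Psi> n x * u x = (\<Sum>j<grid_len n. \<Psi> (grid_pt n j) *
            (W (grid_pt n (Suc j)) x * u x - W (grid_pt n j) x * u x))"
            using GW by eventually_elim (simp add: A_def sum_distrib_left algebra_simps)
        qed measurable
        then show ?thesis using bint(1)[OF u W Wabs] by simp
      qed
      show ?thesis unfolding e1 e2
        by (intro tendsto_sum tendsto_mult tendsto_diff tendsto_const Wlim u)
    qed
    show "((\<lambda>i. LINT x|M. T i \<Psi> x * u x) \<longlongrightarrow> (LINT x|M. (LINT y|\<mu> x. \<Psi> y) * u x)) F"
      unfolding L_def[symmetric]
    proof (rule tendstoI)
      fix d :: real assume d: "d > 0"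
      \<comment> \<open>Adding 1 avoids division by zero when \<open>u\<close> vanishes almost
        everywhere and gives the strict inequality \<open>k * U < d / 3\<close>.\<close>
      define k where "k = d / (3 * (U + 1))"
      have k: "k > 0" using d U0 by (simp add: k_def)
      have kU: "k * U < d / 3"
      proof -
        have "k * U < k * (U + 1)" using k by simp
        also have "\<dots> = d / 3" using U0 by (simp add: k_def field_simps)
        finally show ?thesis .
      qed
      have "eventually (\<lambda>n. dist (LINT x|M. A \<Psi> n x * u x) (LINT x|M. L x * u x) < d / 3) sequentially"
        by (rule tendstoD[OF ALint]) (use d in simp)
      then have "eventually (\<lambda>n. dist (LINT x|M. A \<Psi> n x * u x) (LINT x|M. L x * u x) < d / 3 \<and>
          (\<forall>y. \<bar>step_approx n \<Psi> y - \<Psi> y\<bar> < k)) sequentially"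
        using step_approx_uniform[OF c t k] by eventually_elim blast
      then obtain n where n1: "dist (LINT x|M. A \<Psi> n x * u x) (LINT x|M. L x * u x) < d / 3"
        and n2: "\<And>y. \<bar>step_approx n \<Psi> y - \<Psi> y\<bar> < k"
        using eventually_happens'[OF sequentially_bot] by blast
      \<comment> \<open>Evaluation turns the uniform error of the step function into a pointwise
        error, the same for all \<open>i\<close>; this justifies exchanging the limits in
        \<open>n\<close> and along \<open>F\<close>.\<close>
      have n3: "\<bar>(LINT x|M. T i (step_approx n \<Psi>) x * u x) - (LINT x|M. T i \<Psi> x * u x)\<bar> \<le> k * U" for i
      proof -
        have stC: "\<bar>step_approx n \<Psi> y\<bar> \<le> C + k" for y using n2[of y] C[of y] by linarith
        have le: "\<bar>T i (step_approx n \<Psi>) x - T i \<Psi> x\<bar> \<le> k" for x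
        proof -
          obtain s c where "s = 0 \<or> s = 1" "\<And>h. T i h x = s * h c" using T[of i x] by metis
          then show ?thesis using n2[of c] k by auto
        qed
        have "(LINT x|M. T i (step_approx n \<Psi>) x * u x) - (LINT x|M. T i \<Psi> x * u x) =
            (LINT x|M. (T i (step_approx n \<Psi>) x - T i \<Psi> x) * u x)"
          using bint(1)[OF u Tm Tb[OF stC]] bint(1)[OF u Tm Tb[OF C]] by (simp add: left_diff_distrib)
        then show ?thesis unfolding U_def using bint(2)[OF u _ le] by simp
      qed
      have "eventually (\<lambda>i. dist (LINT x|M. T i (step_approx n \<Psi>) x * u x) (LINT x|M. A \<Psi> n x * u x) < d / 3) F"
        by (rule tendstoD[OF Tstep]) (use d in simp)
      then show "eventually (\<lambda>i. dist (LINT x|M. T i \<Psi> x * u x) (LINT x|M. L x * u x) < d) F"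
      proof (rule eventually_mono)
        fix i assume "dist (LINT x|M. T i (step_approx n \<Psi>) x * u x) (LINT x|M. A \<Psi> n x * u x) < d / 3"
        then show "dist (LINT x|M. T i \<Psi> x * u x) (LINT x|M. L x * u x) < d"
          using n1 n3[of i] kU unfolding dist_real_def by linarith
      qed
    qed
  qed
  then show ?thesis using \<mu> by (intro exI[of _ \<mu>] conjI allI ballI) simp_all
qed

section \<open>Cubes at grid points and Riemann sums\<close>

definition cube :: "real \<Rightarrow> 'a::euclidean_space \<Rightarrow> 'a set" where
  "cube \<epsilon> x = box x (x + \<epsilon> *\<^sub>R One)"

definition cell_fun ::
    "'a::euclidean_space set \<Rightarrow> real \<Rightarrow> ('a \<Rightarrow> real) \<Rightarrow> (real \<Rightarrow> real) \<Rightarrow> 'a \<Rightarrow> real" where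
  "cell_fun D \<epsilon> g h z = (\<Sum>x\<in>D. h (g x) * indicator (cube \<epsilon> x) z)"

lemma cube_borel [measurable]: "cube \<epsilon> x \<in> sets borel"
  by (simp add: cube_def)

lemma emeasure_cube:
  fixes x :: "'a::euclidean_space"
  assumes "\<epsilon> \<ge> 0"
  shows "emeasure lborel (cube \<epsilon> x) = ennreal (\<epsilon> ^ DIM('a))"
proof -
  have "emeasure lborel (cube \<epsilon> x) = ennreal (\<Prod>b\<in>(Basis::'a set). (x + \<epsilon> *\<^sub>R One - x) \<bullet> b)"
    unfolding cube_def by (rule emeasure_lborel_box) (use assms in \<open>simp add: inner_left_distrib\<close>)
  also have "(\<Prod>b\<in>(Basis::'a set). (x + \<epsilon> *\<^sub>R One - x) \<bullet> b) = (\<Prod>b\<in>(Basis::'a set). \<epsilon>)"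
    by (rule prod.cong) auto
  finally show ?thesis by simp
qed

lemma dist_cube:
  fixes x :: "'a::euclidean_space" and \<epsilon> :: real
  assumes "z \<in> cube \<epsilon> x"
  shows "dist z x \<le> real DIM('a) * \<epsilon>"
proof -
  have "norm (z - x) \<le> (\<Sum>b\<in>Basis. \<bar>(z - x) \<bullet> b\<bar>)" by (rule norm_le_l1)
  also have "\<dots> \<le> (\<Sum>b\<in>(Basis::'a set). \<epsilon>)"
    by (rule sum_mono) (use assms in \<open>force simp: cube_def mem_box inner_left_distrib inner_diff_left\<close>)
  finally show ?thesis by (simp add: dist_norm)
qed

text \<open>\<open>s\<close> and \<open>c\<close> do not depend on \<open>h\<close>, so \<open>cell_fun\<close> inherits every pointwise relation between functions \<open>h\<close>.\<close>
lemma cell_fun_eq: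
  assumes "finite D" "disjoint_family_on (cube \<epsilon>) D"
  shows "\<exists>s c. (s = 0 \<or> s = 1) \<and> (\<forall>h. cell_fun D \<epsilon> g h z = s * h c)"
proof (cases "\<exists>x\<in>D. z \<in> cube \<epsilon> x")
  case True
  then obtain x where x: "x \<in> D" "z \<in> cube \<epsilon> x" by blast
  have "cell_fun D \<epsilon> g h z = 1 * h (g x)" for h
  proof -
    have "cell_fun D \<epsilon> g h z = (\<Sum>y\<in>D. if y = x then h (g x) else 0)"
      unfolding cell_fun_def
      by (rule sum.cong) (use x assms(2) in \<open>auto simp: disjoint_family_on_def indicator_def\<close>)
    then show ?thesis using x assms(1) by simp
  qed
  then show ?thesis by blast
next
  case False
  then have "cell_fun D \<epsilon> g h z = 0 * h 0" for h
    by (auto simp: cell_fun_def intro!: sum.neutral)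
  then show ?thesis by blast
qed

lemma cell_fun_borel [measurable]: "cell_fun D \<epsilon> g h \<in> borel_measurable borel"
  unfolding cell_fun_def[abs_def] by measurable

text \<open>On each cube \<open>\<phi>\<close> varies by at most \<open>k\<close>, and disjointness
  bounds the total volume on which this error lives. The threshold is therefore independent of
  \<open>D\<close> and \<open>g\<close>, as it must be when all of them vary along the
  ultrafilter.\<close>

lemma riemann_sum_vs_integral:
  fixes \<phi> :: "'a::euclidean_space \<Rightarrow> real"
  assumes c: "continuous_on UNIV \<phi>" and r: "\<And>z. \<phi> z \<noteq> 0 \<Longrightarrow> norm z \<le> r" and C: "\<And>y. \<bar>\<Psi> y\<bar> \<le> C"
    and d: "d > 0"
  shows "\<exists>e>0. \<forall>D g \<epsilon>. finite D \<longrightarrow> disjoint_family_on (cube \<epsilon>) D \<longrightarrow> 0 < \<epsilon> \<longrightarrow> \<epsilon> < e \<longrightarrow>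
    \<bar>\<epsilon> ^ DIM('a) * (\<Sum>x\<in>D. \<Psi> (g x) * \<phi> x) - (LINT z|lborel. cell_fun D \<epsilon> g \<Psi> z * \<phi> z)\<bar> < d"
proof -
  have C0: "C \<ge> 0" using C[of 0] by linarith
  \<comment> \<open>Points within distance 1 of the region where \<open>\<phi>\<close> can be
    nonzero stay in this ball, so the error of every small cube is carried by it.\<close>
  let ?B = "cball (0::'a) (r + 1)"
  define V where "V = measure lborel ?B"
  have V0: "0 \<le> V" by (simp add: V_def)
  have fB: "emeasure lborel ?B < \<infinity>" by (rule emeasure_bounded_finite) simp
  have [measurable]: "?B \<in> sets borel" by (simp add: borel_closed)
  \<comment> \<open>Chosen so that the total error \<open>C * (k * V)\<close> is strictly below
    \<open>d\<close>, also when \<open>C * V = 0\<close>.\<close>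
  define k where "k = d / (C * V + 1)"
  have CV: "C * V + 1 > 0" using C0 V0 by (simp add: add_nonneg_pos)
  then have k: "k > 0" using d by (simp add: k_def)
  have kd: "C * (k * V) < d"
  proof -
    have "C * (k * V) < k * (C * V + 1)" using k by (simp add: algebra_simps)
    also have "\<dots> = d" using CV by (simp add: k_def)
    finally show ?thesis .
  qed
  have "uniformly_continuous_on ?B \<phi>"
    by (rule compact_uniformly_continuous) (use c continuous_on_subset in auto)
  then obtain e where e: "e > 0" and ue: "\<And>x z. x \<in> ?B \<Longrightarrow> z \<in> ?B \<Longrightarrow> dist z x < e \<Longrightarrow> dist (\<phi> z) (\<phi> x) < k"
    using k unfolding uniformly_continuous_on_def by metis
  have close: "\<bar>\<phi> x - \<phi> z\<bar> \<le> k * indicator ?B z" if "dist z x < min e 1" for x z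
  proof (cases "norm x \<le> r \<or> norm z \<le> r")
    case True
    have "norm x \<le> norm z + dist z x" "norm z \<le> norm x + dist z x"
      by (metis dist_norm norm_triangle_sub add.commute norm_minus_commute)+
    then have "x \<in> ?B" "z \<in> ?B" using True that by (auto simp: dist_norm)
    then show ?thesis using ue[of x z] that by (simp add: dist_real_def abs_minus_commute)
  next
    case False
    then have "\<phi> x = 0" "\<phi> z = 0" using r[of x] r[of z] by auto
    then show ?thesis using k by simp
  qed
  have cm[measurable]: "\<phi> \<in> borel_measurable borel" by (rule borel_measurable_continuous_onI[OF c])
  \<comment> \<open>A point of a cube lies within \<open>DIM('a) * \<epsilon>\<close> of its corner,
    by the l1 bound on the norm.\<close>
  define m where "m = min e 1 / DIM('a)"
  have "m > 0" using e by (simp add: m_def)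
  moreover have "\<bar>\<epsilon> ^ DIM('a) * (\<Sum>x\<in>D. \<Psi> (g x) * \<phi> x) - (LINT z|lborel. cell_fun D \<epsilon> g \<Psi> z * \<phi> z)\<bar> < d"
    if D: "finite D" "disjoint_family_on (cube \<epsilon>) D" and \<epsilon>: "0 < \<epsilon>" "\<epsilon> < m" for D g \<epsilon>
  proof -
    have mc: "measure lborel (cube \<epsilon> x) = \<epsilon> ^ DIM('a)" for x :: 'a
      using emeasure_cube[of \<epsilon> x] \<epsilon> by (simp add: measure_def)
    have fc: "emeasure lborel (cube \<epsilon> x) < \<infinity>" for x :: 'a
      using emeasure_cube[of \<epsilon> x] \<epsilon> by simp
    have near: "dist z x < min e 1" if "z \<in> cube \<epsilon> x" for x z :: 'a
    proof -
      have "real DIM('a) * \<epsilon> < real DIM('a) * m" using \<epsilon> by simp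
      then show ?thesis using dist_cube[OF that] by (simp add: m_def)
    qed
    have ii: "integrable lborel (indicator (cube \<epsilon> x) :: 'a \<Rightarrow> real)" for x
      by (rule integrable_real_indicator[OF _ fc]) simp
    have iB: "integrable lborel (\<lambda>z. indicator ?B z :: real)"
      using integrable_real_indicator[OF _ fB] by simp
    have ip: "integrable lborel (\<lambda>z. indicator (cube \<epsilon> x) z * \<phi> z)" for x
    proof (rule Bochner_Integration.integrable_bound[where f="\<lambda>z. (\<bar>\<phi> x\<bar> + k) * indicator (cube \<epsilon> x) z"])
      show "AE z in lborel. norm (indicator (cube \<epsilon> x) z * \<phi> z) \<le> norm ((\<bar>\<phi> x\<bar> + k) * indicator (cube \<epsilon> x) z)"
      proof (rule AE_I2)
        fix z
        show "norm (indicator (cube \<epsilon> x) z * \<phi> z) \<le> norm ((\<bar>\<phi> x\<bar> + k) * indicator (cube \<epsilon> x) z)"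
        proof (cases "z \<in> cube \<epsilon> x")
          case True
          then have "\<bar>\<phi> x - \<phi> z\<bar> \<le> k" using order_trans[OF close[OF near[OF True]], of k] k by (simp add: indicator_def)
          then show ?thesis using True k by simp
        qed simp
      qed
    qed (use ii in auto)
    have s1: "\<epsilon> ^ DIM('a) * (\<Sum>x\<in>D. \<Psi> (g x) * \<phi> x) = (\<Sum>x\<in>D. \<Psi> (g x) * (LINT z|lborel. \<phi> x * indicator (cube \<epsilon> x) z))"
      by (simp add: mc sum_distrib_left algebra_simps)
    have s2: "(LINT z|lborel. cell_fun D \<epsilon> g \<Psi> z * \<phi> z) = (\<Sum>x\<in>D. \<Psi> (g x) * (LINT z|lborel. indicator (cube \<epsilon> x) z * \<phi> z))"
    proof -
      have "(LINT z|lborel. cell_fun D \<epsilon> g \<Psi> z * \<phi> z) = (LINT z|lborel. (\<Sum>x\<in>D. \<Psi> (g x) * (indicator (cube \<epsilon> x) z * \<phi> z)))"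
        by (simp add: cell_fun_def sum_distrib_right mult.assoc)
      also have "\<dots> = (\<Sum>x\<in>D. \<Psi> (g x) * (LINT z|lborel. indicator (cube \<epsilon> x) z * \<phi> z))"
        by (subst Bochner_Integration.integral_sum) (use ip in auto)
      finally show ?thesis .
    qed
    have "\<epsilon> ^ DIM('a) * (\<Sum>x\<in>D. \<Psi> (g x) * \<phi> x) - (LINT z|lborel. cell_fun D \<epsilon> g \<Psi> z * \<phi> z) =
      (\<Sum>x\<in>D. \<Psi> (g x) * (LINT z|lborel. indicator (cube \<epsilon> x) z * (\<phi> x - \<phi> z)))"
    proof -
      have "(LINT z|lborel. indicator (cube \<epsilon> x) z * (\<phi> x - \<phi> z)) =
        (LINT z|lborel. \<phi> x * indicator (cube \<epsilon> x) z) - (LINT z|lborel. indicator (cube \<epsilon> x) z * \<phi> z)" for x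
      proof -
        have "integrable lborel (\<lambda>z. \<phi> x * indicator (cube \<epsilon> x) z)" using ii by simp
        from Bochner_Integration.integral_diff[OF this ip[of x], symmetric]
        show ?thesis by (simp add: right_diff_distrib mult.commute[of "\<phi> x"])
      qed
      then show ?thesis unfolding s1 s2 by (simp only: sum_subtractf[symmetric] right_diff_distrib)
    qed
    also have "\<bar>\<dots>\<bar> \<le> (\<Sum>x\<in>D. C * (LINT z|lborel. indicator (cube \<epsilon> x) z * (k * indicator ?B z)))"
    proof (rule order_trans[OF sum_abs sum_mono])
      fix x
      have i1: "integrable lborel (\<lambda>z. indicator (cube \<epsilon> x) z * (\<phi> x - \<phi> z))"
        using ip[of x] ii[of x] by (simp add: right_diff_distrib)
      have i2: "integrable lborel (\<lambda>z. indicator (cube \<epsilon> x) z * (k * indicator ?B z))"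
        using integrable_mult_indicator[of "cube \<epsilon> x" lborel "\<lambda>z. k * indicator ?B z"] iB by simp
      have "\<bar>LINT z|lborel. indicator (cube \<epsilon> x) z * (\<phi> x - \<phi> z)\<bar> \<le> (LINT z|lborel. \<bar>indicator (cube \<epsilon> x) z * (\<phi> x - \<phi> z)\<bar>)"
        by (rule integral_abs_bound)
      also have "\<dots> \<le> (LINT z|lborel. indicator (cube \<epsilon> x) z * (k * indicator ?B z))"
      proof (rule integral_mono)
        fix z
        show "\<bar>indicator (cube \<epsilon> x) z * (\<phi> x - \<phi> z)\<bar> \<le> indicator (cube \<epsilon> x) z * (k * indicator ?B z)"
          using close[OF near, of z x] by (cases "z \<in> cube \<epsilon> x") simp_all
      qed (use i1 i2 in auto)
      finally show "\<bar>\<Psi> (g x) * (LINT z|lborel. indicator (cube \<epsilon> x) z * (\<phi> x - \<phi> z))\<bar> \<le>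
        C * (LINT z|lborel. indicator (cube \<epsilon> x) z * (k * indicator ?B z))"
        unfolding abs_mult by (intro mult_mono) (use C C0 in auto)
    qed
    \<comment> \<open>The constant function 1 turns the sum of indicators into a
      \<open>cell_fun\<close>, which is at most 1; so the number of cubes drops out of the
      estimate.\<close>
    also have "\<dots> = C * (LINT z|lborel. cell_fun D \<epsilon> g (\<lambda>_. 1) z * (k * indicator ?B z))"
    proof -
      have i2: "integrable lborel (\<lambda>z. indicator (cube \<epsilon> x) z * (k * indicator ?B z))" for x
        using integrable_mult_indicator[of "cube \<epsilon> x" lborel "\<lambda>z. k * indicator ?B z"] iB by simp
      have "(LINT z|lborel. cell_fun D \<epsilon> g (\<lambda>_. 1) z * (k * indicator ?B z)) =
        (LINT z|lborel. (\<Sum>x\<in>D. indicator (cube \<epsilon> x) z * (k * indicator ?B z)))"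
        by (simp add: cell_fun_def sum_distrib_right)
      also have "\<dots> = (\<Sum>x\<in>D. (LINT z|lborel. indicator (cube \<epsilon> x) z * (k * indicator ?B z)))"
        by (subst Bochner_Integration.integral_sum) (use i2 in auto)
      finally show ?thesis by (simp only: sum_distrib_left)
    qed
    also have "\<dots> \<le> C * (k * V)"
    proof (rule mult_left_mono[OF _ C0])
      have i3: "integrable lborel (\<lambda>z. k * indicator ?B z)" using iB by simp
      have cf: "0 \<le> cell_fun D \<epsilon> g (\<lambda>_. 1) z \<and> cell_fun D \<epsilon> g (\<lambda>_. 1) z \<le> 1" for z
        using cell_fun_eq[OF D, of g z] by (auto dest: spec[of _ "\<lambda>_. 1"])
      have "(LINT z|lborel. cell_fun D \<epsilon> g (\<lambda>_. 1) z * (k * indicator ?B z)) \<le> (LINT z|lborel. k * indicator ?B z)"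
      proof (rule integral_mono[OF _ i3])
        show "integrable lborel (\<lambda>z. cell_fun D \<epsilon> g (\<lambda>_. 1) z * (k * indicator ?B z))"
        proof (rule Bochner_Integration.integrable_bound[OF i3])
          show "(\<lambda>z. cell_fun D \<epsilon> g (\<lambda>_. 1) z * (k * indicator ?B z)) \<in> borel_measurable lborel"
            by (simp, measurable)
        qed (use cf k in \<open>auto intro!: mult_left_le_one_le simp: abs_mult\<close>)
        show "cell_fun D \<epsilon> g (\<lambda>_. 1) z * (k * indicator ?B z) \<le> k * indicator ?B z" for z
          by (rule mult_left_le_one_le) (use cf[of z] k in auto)
      qed
      also have "\<dots> = k * V" unfolding V_def by simp
      finally show "(LINT z|lborel. cell_fun D \<epsilon> g (\<lambda>_. 1) z * (k * indicator ?B z)) \<le> k * V" .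
    qed
    also note kd
    finally show ?thesis .
  qed
  ultimately show ?thesis by (intro exI[of _ m] conjI allI impI)
qed

section \<open>Finite Borel measures as Radon measures\<close>

lemma total_variation_measure:
  assumes M: "finite_measure M" "sets M = sets borel" and A: "A \<in> sets borel"
  shows "total_variation (measure M) A \<le> emeasure M A"
  unfolding total_variation_def
proof (rule SUP_least)
  interpret finite_measure M by fact
  fix P assume "P \<in> {P. finite P \<and> disjoint P \<and> P \<subseteq> sets borel \<and> \<Union>P \<subseteq> A}"
  then have P: "finite P" "disjoint P" "P \<subseteq> sets borel" "\<Union>P \<subseteq> A" by auto
  have "(\<Sum>B\<in>P. ennreal \<bar>measure M B\<bar>) = (\<Sum>B\<in>P. emeasure M B)"
    by (simp add: emeasure_eq_measure)
  also have "\<dots> = emeasure M (\<Union>B\<in>P. B)"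
    by (rule sum_emeasure) (use P M in \<open>auto simp: disjoint_family_on_def disjoint_def\<close>)
  also have "\<dots> \<le> emeasure M A" by (rule emeasure_mono) (use P A M in auto)
  finally show "(\<Sum>B\<in>P. ennreal \<bar>measure M B\<bar>) \<le> emeasure M A" .
qed

text \<open>Inner regularity of finite Borel measures on the line supplies the compact sets. The
  total variation of a nonnegative measure is at most the measure itself, so approximation in
  measure is approximation in variation.\<close>

lemma measure_in_radon_measures:
  assumes M: "finite_measure M" "sets M = sets borel"
  shows "measure M \<in> radon_measures"
proof -
  interpret finite_measure M by fact
  have "(\<lambda>i. measure M (A i)) sums measure M (\<Union>i. A i)"
    if "range A \<subseteq> sets borel" "disjoint_family A" for A :: "nat \<Rightarrow> real set"
    by (rule finite_measure_UNION) (use that M in auto)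
  moreover have "\<exists>K. compact K \<and> K \<subseteq> A \<and> total_variation (measure M) (A - K) < ennreal \<delta>"
    if A: "A \<in> sets borel" and \<delta>: "\<delta> > 0" for A and \<delta> :: real
  proof -
    have inner: "emeasure M A = (SUP K\<in>{K. K \<subseteq> A \<and> compact K}. emeasure M K)"
      by (rule inner_regular) (use M A in auto)
    obtain K where K: "K \<subseteq> A" "compact K" "measure M A < measure M K + \<delta>"
    \<comment> \<open>\<open>ennreal\<close> truncates negative reals to 0, which could spoil the
      strict inequality of the second case; here the empty set suffices.\<close>
    proof (cases "measure M A < \<delta>")
      case True
      then show thesis using that[of "{}"] by simp
    next
      case False
      then have "ennreal (measure M A - \<delta>) < emeasure M A"
        using \<delta> by (simp add: emeasure_eq_measure ennreal_less_iff)
      then obtain K where "K \<subseteq> A" "compact K" "ennreal (measure M A - \<delta>) < emeasure M K"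
        unfolding inner less_SUP_iff by auto
      then show thesis using that[of K] False by (simp add: emeasure_eq_measure ennreal_less_iff)
    qed
    have Kb: "K \<in> sets borel" using K(2) by (simp add: borel_compact)
    have "total_variation (measure M) (A - K) \<le> emeasure M (A - K)"
      by (rule total_variation_measure[OF M]) (use A Kb in auto)
    also have "measure M (A - K) = measure M A - measure M K"
      by (rule finite_measure_Diff) (use A Kb M K in auto)
    then have "emeasure M (A - K) < ennreal \<delta>"
      unfolding emeasure_eq_measure using K(3) by (intro ennreal_lessI[OF \<delta>]) simp
    finally show ?thesis using K by blast
  qed
  moreover have "total_variation (measure M) UNIV < \<infinity>"
    by (rule order.strict_trans1[OF total_variation_measure[OF M]]) (simp_all add: less_top[symmetric])
  ultimately show ?thesis unfolding radon_measures_def by blast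
qed

text \<open>By monotonicity the supremum in the positive variation is attained at \<open>A\<close>
  itself. For the negated measure \<open>ennreal\<close> sends every value to 0, so the negative
  variation is the null measure.\<close>

lemma signed_integral_measure:
  assumes M: "finite_measure M" "sets M = sets borel"
  shows "signed_integral (measure M) \<Psi> = (LINT y|M. \<Psi> y)"
proof -
  interpret finite_measure M by fact
  have sp: "space M = UNIV" using sets_eq_imp_space_eq[OF M(2)] by simp
  have "pos_variation (measure M) = measure_of UNIV (sets borel) (emeasure M)"
    unfolding pos_variation_def
  proof (rule measure_of_eq)
    fix A :: "real set" assume "A \<in> sigma_sets UNIV (sets borel)"
    then have A: "A \<in> sets borel" by (metis sets.sigma_sets_eq space_borel)
    show "(SUP B\<in>{B \<in> sets borel. B \<subseteq> A}. ennreal (measure M B)) = emeasure M A"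
    proof (rule antisym)
      show "(SUP B\<in>{B \<in> sets borel. B \<subseteq> A}. ennreal (measure M B)) \<le> emeasure M A"
        by (rule SUP_least) (use A M in \<open>auto simp: emeasure_eq_measure[symmetric] intro!: emeasure_mono\<close>)
      show "emeasure M A \<le> (SUP B\<in>{B \<in> sets borel. B \<subseteq> A}. ennreal (measure M B))"
        unfolding emeasure_eq_measure by (rule SUP_upper) (use A in auto)
    qed
  qed simp
  also have "\<dots> = M" using measure_of_of_measure[of M] sp M(2) by simp
  finally have p: "pos_variation (measure M) = M" .
  have "pos_variation (\<lambda>A. - measure M A) = measure_of UNIV (sets borel) (\<lambda>_. 0)"
    unfolding pos_variation_def
  proof (rule measure_of_eq)
    fix A :: "real set"
    have "ennreal (- measure M B) = 0" for B by (simp add: ennreal_neg)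
    then show "(SUP B\<in>{B \<in> sets borel. B \<subseteq> A}. ennreal (- measure M B)) = 0"
      by (auto simp: bot_ennreal[symmetric] intro!: SUP_bot)
  qed simp
  also have "\<dots> = null_measure borel"
    using sets.sigma_sets_eq[of "borel :: real measure"] by (intro measure_eqI) (simp_all add: emeasure_sigma)
  finally have n: "pos_variation (\<lambda>A. - measure M A) = null_measure borel" .
  have "(LINT y|null_measure borel. \<Psi> y) = 0"
    by (rule integral_eq_zero_AE, rule AE_I'[of UNIV]) (auto simp: null_sets_def)
  then show ?thesis unfolding signed_integral_def p n by simp
qed

text \<open>The kernel is built on the whole space, because cubes with a corner near the boundary
  may leave \<open>\<Omega>\<close>. Only afterwards are the measures considered over
  \<open>\<Omega>\<close>.\<close>

lemma young_measure_along_ultrafilter: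
  fixes D :: "'i \<Rightarrow> (real ^ ('n::finite)) set" and \<Omega> :: "(real ^ 'n) set"
  assumes F: "is_ultrafilter F" and \<Omega>: "open \<Omega>"
    and D: "\<And>i. finite (D i)" "\<And>i. disjoint_family_on (cube (eps i)) (D i)" "\<And>i. D i \<subseteq> \<Omega>"
    and eps: "\<And>i. eps i > 0" "(eps \<longlongrightarrow> 0) F"
  shows "\<exists>\<nu>. parametrized_measure \<Omega> \<nu> \<and>
    (\<forall>\<Psi>\<in>C0b. \<forall>\<phi>\<in>C0c \<Omega>.
       ((\<lambda>i. eps i ^ CARD('n) * (\<Sum>x\<in>D i. \<Psi> (g i x) * \<phi> x)) \<longlongrightarrow>
         (LINT x:\<Omega>|lebesgue. signed_integral (\<nu> x) \<Psi> * \<phi> x)) F) \<and>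
    (\<forall>x\<in>\<Omega>. \<forall>A\<in>sets borel. 0 \<le> \<nu> x A \<and> \<nu> x A \<le> 1)"
proof -
  have cm: "cell_fun (D i) (eps i) (g i) h \<in> borel_measurable lborel" for i h
    using cell_fun_borel by simp
  have "\<exists>\<mu>. (\<forall>x. sets (\<mu> x) = sets borel \<and> emeasure (\<mu> x) UNIV \<le> 1) \<and>
    (\<forall>\<Psi>\<in>C0b. (\<lambda>x. LINT y|\<mu> x. \<Psi> y) \<in> borel_measurable lborel \<and>
      (\<forall>u. integrable lborel u \<longrightarrow> ((\<lambda>i. LINT x|lborel. cell_fun (D i) (eps i) (g i) \<Psi> x * u x) \<longlongrightarrow>
        (LINT x|lborel. (LINT y|\<mu> x. \<Psi> y) * u x)) F))"
    by (rule weak_limit_kernel[where T="\<lambda>i. cell_fun (D i) (eps i) (g i)",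
          OF F sigma_finite_lborel cell_fun_eq[OF D(1,2)] cm])
  then obtain \<mu> where \<mu>_all: "(\<forall>x. sets (\<mu> x) = sets borel \<and> emeasure (\<mu> x) UNIV \<le> 1) \<and>
    (\<forall>\<Psi>\<in>C0b. (\<lambda>x. LINT y|\<mu> x. \<Psi> y) \<in> borel_measurable lborel \<and>
      (\<forall>u. integrable lborel u \<longrightarrow> ((\<lambda>i. LINT x|lborel. cell_fun (D i) (eps i) (g i) \<Psi> x * u x) \<longlongrightarrow>
        (LINT x|lborel. (LINT y|\<mu> x. \<Psi> y) * u x)) F))" ..
  then have \<mu>: "sets (\<mu> x) = sets borel" "emeasure (\<mu> x) UNIV \<le> 1" for x by simp_all
  have \<mu>m: "(\<lambda>x. LINT y|\<mu> x. \<Psi> y) \<in> borel_measurable lborel" if "\<Psi> \<in> C0b" for \<Psi>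
    using \<mu>_all that by simp
  have lim: "((\<lambda>i. LINT x|lborel. cell_fun (D i) (eps i) (g i) \<Psi> x * u x) \<longlongrightarrow>
      (LINT x|lborel. (LINT y|\<mu> x. \<Psi> y) * u x)) F" if "\<Psi> \<in> C0b" "integrable lborel u" for \<Psi> u
    using \<mu>_all that by simp
  have fin: "finite_measure (\<mu> x)" for x
  proof
    show "emeasure (\<mu> x) (space (\<mu> x)) \<noteq> \<infinity>"
      using \<mu>(2)[of x] sets_eq_imp_space_eq[OF \<mu>(1)[of x]] by (auto simp: top_unique)
  qed
  define \<nu> where "\<nu> x = measure (\<mu> x)" for x
  have si: "signed_integral (\<nu> x) \<Psi> = (LINT y|\<mu> x. \<Psi> y)" for x \<Psi>
    unfolding \<nu>_def by (rule signed_integral_measure[OF fin \<mu>(1)])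
  have "parametrized_measure \<Omega> \<nu>"
    unfolding parametrized_measure_def si
  proof (intro conjI ballI)
    show "\<nu> x \<in> radon_measures" for x unfolding \<nu>_def by (rule measure_in_radon_measures[OF fin \<mu>(1)])
    fix \<Psi> :: "real \<Rightarrow> real" assume "\<Psi> \<in> C0b"
    from \<mu>m[OF this] show "(\<lambda>x. LINT y|\<mu> x. \<Psi> y) \<in> borel_measurable (lebesgue_on \<Omega>)"
      by (intro measurable_restrict_space1 measurable_completion)
  qed
  moreover have "0 \<le> \<nu> x A \<and> \<nu> x A \<le> 1" for x A
  proof -
    interpret finite_measure "\<mu> x" by (rule fin)
    have "measure (\<mu> x) A \<le> measure (\<mu> x) (space (\<mu> x))" by (rule bounded_measure)
    also have "\<dots> \<le> 1"
      using \<mu>(2)[of x] sets_eq_imp_space_eq[OF \<mu>(1)[of x]] by (simp add: emeasure_eq_measure)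
    finally show ?thesis by (simp add: \<nu>_def)
  qed
  moreover have "((\<lambda>i. eps i ^ CARD('n) * (\<Sum>x\<in>D i. \<Psi> (g i x) * \<phi> x)) \<longlongrightarrow>
         (LINT x:\<Omega>|lebesgue. signed_integral (\<nu> x) \<Psi> * \<phi> x)) F"
    if \<Psi>: "\<Psi> \<in> C0b" and \<phi>: "\<phi> \<in> C0c \<Omega>" for \<Psi> \<phi>
  proof -
    \<comment> \<open>Values of \<open>\<phi>\<close> outside \<open>\<Omega>\<close> are arbitrary.
      The extension by zero is continuous everywhere, since \<open>\<Omega>\<close> and the
      complement of \<open>K\<close> are open and cover the space.\<close>
    define \<phi>0 where "\<phi>0 x = (if x \<in> \<Omega> then \<phi> x else 0)" for x
    define K where "K = closure {x \<in> \<Omega>. \<phi> x \<noteq> 0}"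
    have K: "compact K" "K \<subseteq> \<Omega>" "continuous_on \<Omega> \<phi>" using \<phi> by (auto simp: C0c_def K_def)
    have z: "\<phi>0 x = 0" if "x \<notin> K" for x
      using that closure_subset[of "{x \<in> \<Omega>. \<phi> x \<noteq> 0}"] by (auto simp: \<phi>0_def K_def)
    have "continuous_on (\<Omega> \<union> - K) \<phi>0"
    proof (rule continuous_on_open_Un)
      show "continuous_on \<Omega> \<phi>0" using K(3) by (simp add: \<phi>0_def cong: continuous_on_cong)
      have "continuous_on (- K) (\<lambda>_. 0 :: real)" by simp
      then show "continuous_on (- K) \<phi>0"
        by (subst continuous_on_cong[OF refl, of _ _ "\<lambda>_. 0"]) (simp_all add: z)
      show "open \<Omega>" "open (- K)" using \<Omega> K(1) by (auto simp: compact_imp_closed)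
    qed
    moreover have "\<Omega> \<union> - K = UNIV" using K(2) by auto
    ultimately have c0: "continuous_on UNIV \<phi>0" by simp
    obtain r where r: "\<And>x. x \<in> K \<Longrightarrow> norm x \<le> r" using K(1) compact_imp_bounded bounded_iff by metis
    have r0: "norm x \<le> r" if "\<phi>0 x \<noteq> 0" for x using r[of x] z[of x] that by auto
    have int0: "integrable lborel \<phi>0"
    proof -
      have "integrable lborel (\<lambda>x. indicator K x *\<^sub>R \<phi>0 x)"
        by (rule borel_integrable_compact[OF K(1)]) (rule continuous_on_subset[OF c0], simp)
      moreover have "(\<lambda>x. indicator K x *\<^sub>R \<phi>0 x) = \<phi>0" using z by (auto simp: indicator_def fun_eq_iff)
      ultimately show ?thesis by simp
    qed
    obtain C where C: "\<And>y. \<bar>\<Psi> y\<bar> \<le> C"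
    proof -
      have "bounded (range \<Psi>)" using \<Psi> by (simp add: C0b_def)
      then show thesis by (rule bounded_range_abs_le) (rule that)
    qed
    \<comment> \<open>The kernel integral and \<open>\<phi>0\<close> are Borel measurable, so
      passing to the completed measure does not change the integral.\<close>
    have eq: "(LINT x:\<Omega>|lebesgue. signed_integral (\<nu> x) \<Psi> * \<phi> x) = (LINT x|lborel. (LINT y|\<mu> x. \<Psi> y) * \<phi>0 x)"
    proof -
      have "(LINT x:\<Omega>|lebesgue. signed_integral (\<nu> x) \<Psi> * \<phi> x) = (LINT x|lebesgue. (LINT y|\<mu> x. \<Psi> y) * \<phi>0 x)"
        unfolding set_lebesgue_integral_def si
        by (rule Bochner_Integration.integral_cong) (auto simp: \<phi>0_def indicator_def)
      also have "\<dots> = (LINT x|lborel. (LINT y|\<mu> x. \<Psi> y) * \<phi>0 x)"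
        by (rule integral_completion) (use \<mu>m[OF \<Psi>] int0 in measurable)
      finally show ?thesis .
    qed
    have Deq: "(\<Sum>x\<in>D i. \<Psi> (g i x) * \<phi> x) = (\<Sum>x\<in>D i. \<Psi> (g i x) * \<phi>0 x)" for i
      by (rule sum.cong) (use D(3)[of i] in \<open>auto simp: \<phi>0_def\<close>)
    let ?R = "\<lambda>i. eps i ^ DIM(real ^ 'n) * (\<Sum>x\<in>D i. \<Psi> (g i x) * \<phi>0 x)"
    let ?I = "\<lambda>i. LINT x|lborel. cell_fun (D i) (eps i) (g i) \<Psi> x * \<phi>0 x"
    have "((\<lambda>i. ?R i - ?I i) \<longlongrightarrow> 0) F"
    proof (rule tendstoI)
      fix d :: real assume d: "d > 0"
      have "\<exists>e>0. \<forall>D g \<epsilon>. finite D \<longrightarrow> disjoint_family_on (cube \<epsilon>) D \<longrightarrow> 0 < \<epsilon> \<longrightarrow> \<epsilon> < e \<longrightarrow>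
         \<bar>\<epsilon> ^ DIM(real ^ 'n) * (\<Sum>x\<in>D. \<Psi> (g x) * \<phi>0 x) - (LINT z|lborel. cell_fun D \<epsilon> g \<Psi> z * \<phi>0 z)\<bar> < d"
        by (rule riemann_sum_vs_integral[where r=r and C=C]) (use c0 r0 C d in auto)
      then obtain e where e: "e > 0"
        and R: "\<forall>D g \<epsilon>. finite D \<longrightarrow> disjoint_family_on (cube \<epsilon>) D \<longrightarrow> 0 < \<epsilon> \<longrightarrow> \<epsilon> < e \<longrightarrow>
           \<bar>\<epsilon> ^ DIM(real ^ 'n) * (\<Sum>x\<in>D. \<Psi> (g x) * \<phi>0 x) - (LINT z|lborel. cell_fun D \<epsilon> g \<Psi> z * \<phi>0 z)\<bar> < d"
        by (elim exE conjE) (rule that)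
      have "eventually (\<lambda>i. eps i < e) F" by (rule order_tendstoD(2)[OF eps(2) e])
      then show "eventually (\<lambda>i. dist (?R i - ?I i) 0 < d) F"
      proof (rule eventually_mono)
        fix i assume "eps i < e"
        then show "dist (?R i - ?I i) 0 < d" using R D(1,2)[of i] eps(1)[of i] by (simp add: dist_real_def)
      qed
    qed
    from tendsto_add[OF this lim[OF \<Psi> int0]]
    show ?thesis unfolding eq Deq by simp
  qed
  ultimately show ?thesis by (intro exI[of _ \<nu>] conjI ballI) simp_all
qed

section \<open>Transfer\<close>

definition Imp :: "'u formula \<Rightarrow> 'u formula \<Rightarrow> 'u formula" where
  "Imp \<phi> \<psi> = Neg (Conj \<phi> (Neg \<psi>))"

definition Iff :: "'u formula \<Rightarrow> 'u formula \<Rightarrow> 'u formula" where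
  "Iff \<phi> \<psi> = Conj (Imp \<phi> \<psi>) (Imp \<psi> \<phi>)"

definition Exists :: "nat \<Rightarrow> 'u formula \<Rightarrow> 'u formula" where
  "Exists x \<phi> = Neg (Forall x (Neg \<phi>))"

definition In :: "'u set \<Rightarrow> nat \<Rightarrow> 'u formula" where
  "In A x = Rel {[a] | a. a \<in> A} [x]"

definition Rel2 :: "('u \<Rightarrow> 'u \<Rightarrow> bool) \<Rightarrow> nat \<Rightarrow> nat \<Rightarrow> 'u formula" where
  "Rel2 R x y = Rel {[a, b] | a b. R a b} [x, y]"

text \<open>Formulas have relation symbols only, so a function enters through its graph and every
  intermediate value needs a variable of its own.\<close>

definition Fun1 :: "('u \<Rightarrow> 'u) \<Rightarrow> nat \<Rightarrow> nat \<Rightarrow> 'u formula" where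
  "Fun1 F x y = Rel {[a, F a] | a. True} [x, y]"

definition Fun2 :: "('u \<Rightarrow> 'u \<Rightarrow> 'u) \<Rightarrow> nat \<Rightarrow> nat \<Rightarrow> nat \<Rightarrow> 'u formula" where
  "Fun2 F x y z = Rel {[a, b, F a b] | a b. True} [x, y, z]"

lemma sat_derived [simp]:
  "sat I v (Imp \<phi> \<psi>) \<longleftrightarrow> (sat I v \<phi> \<longrightarrow> sat I v \<psi>)"
  "sat I v (Iff \<phi> \<psi>) \<longleftrightarrow> (sat I v \<phi> \<longleftrightarrow> sat I v \<psi>)"
  "sat I v (Exists x \<phi>) \<longleftrightarrow> (\<exists>a. sat I (v(x := a)) \<phi>)"
  "sat I v (In A x) \<longleftrightarrow> v x \<in> star_set I A"
  "sat I v (Rel2 R x y) \<longleftrightarrow> star_rel I R (v x) (v y)"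
  by (auto simp: Imp_def Iff_def Exists_def In_def Rel2_def star_set_def star_rel_def)

text \<open>Together with \<open>sat_star\<close> this makes simplification translate a formula in
  both structures: in the standard one into the plain statement, in the extension into the statement
  about starred notions.\<close>

lemma sat_standard [simp]:
  "star_set (\<lambda>R. R) A = A"
  "star_rel (\<lambda>R. R) R = R"
  "sat (\<lambda>R. R) v (Fun1 F x y) \<longleftrightarrow> v y = F (v x)"
  "sat (\<lambda>R. R) v (Fun2 G x y z) \<longleftrightarrow> v z = G (v x) (v y)"
  by (auto simp: star_set_def star_rel_def Fun1_def Fun2_def fun_eq_iff)

lemma num_eq_iff [simp]: "num r = num s \<longleftrightarrow> r = s"
  by (simp add: num_def)

lemma pnt_eq_iff [simp]: "pnt p = pnt q \<longleftrightarrow> p = q"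
  by (simp add: pnt_def)

lemma val_num [simp]: "val (num r) = r"
  by (simp add: num_def)

lemma vec_val_pnt [simp]: "vec_val (pnt p) = p"
  by (simp add: pnt_def)

lemma incl_eq_Ur_iff [simp]: "Ur u = incl a \<longleftrightarrow> a = Ur u"
  by (cases a) (auto simp: incl_def)

lemma opair_pnt_num: "opair (pnt p) (num r) = Pr (Ur (Point p)) (Ur (Scalar r))"
  unfolding opair_def pnt_def num_def by (rule the_equality) auto

lemma inj_lift_layer: "inj h \<Longrightarrow> inj (lift_layer h)"
proof (rule injI)
  fix x y
  assume "inj h" "lift_layer h x = lift_layer h y"
  then show "x = y" by (cases x; cases y) (auto dest: injD simp: inj_image_eq_iff)
qed

lemma inj_incl: "inj incl"
  unfolding incl_def by (intro inj_lift_layer injI) simp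

lemma mem_St_extensional:
  assumes "\<forall>p. mem p (St A) \<longleftrightarrow> mem p (St B)"
  shows "A = B"
proof -
  have "incl ` A = incl ` B" using assms by (auto simp: mem_def)
  then show ?thesis by (simp only: inj_image_eq_iff[OF inj_incl])
qed

locale nonstandard =
  fixes e :: "('n::finite) universe \<Rightarrow> 'w" and S :: "'n universe list set \<Rightarrow> 'w list set"
  assumes ext: "nonstandard_extension e S"
begin

lemma transfer: "sat (\<lambda>R. R) v \<phi> \<Longrightarrow> sat S (e \<circ> v) \<phi>"
  using ext by (simp add: nonstandard_extension_def)

text \<open>Existence and uniqueness of the value are first-order and transfer, so the definite
  description in \<open>star1\<close> denotes.\<close>

lemma star1_iff: "[x, y] \<in> S {[a, F a] | a. True} \<longleftrightarrow> y = star1 S F x"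
proof -
  let ?R = "{[a, F a] | a. True}"
  have "sat (\<lambda>R. R) v (Forall 0 (Exists 1 (Conj (Rel ?R [0,1]) (Forall 2 (Imp (Rel ?R [0,2]) (Equal 2 1))))))" for v
    by simp
  from transfer[OF this] have "\<exists>y. [x, y] \<in> S ?R \<and> (\<forall>z. [x, z] \<in> S ?R \<longrightarrow> z = y)" by simp
  then obtain y' where y': "[x, y'] \<in> S ?R" "\<And>z. [x, z] \<in> S ?R \<Longrightarrow> z = y'" by auto
  have "star1 S F x = y'" unfolding star1_def using y'(1) by (rule the_equality) (rule y'(2))
  then show ?thesis using y'(1) by (simp only:) (rule iffI, erule y'(2), simp only:)
qed

lemma star2_iff: "[x, y, z] \<in> S {[a, b, F a b] | a b. True} \<longleftrightarrow> z = star2 S F x y"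
proof -
  let ?R = "{[a, b, F a b] | a b. True}"
  have "sat (\<lambda>R. R) v (Forall 0 (Forall 1 (Exists 2 (Conj (Rel ?R [0,1,2])
      (Forall 3 (Imp (Rel ?R [0,1,3]) (Equal 3 2)))))))" for v
    by simp
  from transfer[OF this] have "\<exists>z. [x, y, z] \<in> S ?R \<and> (\<forall>u. [x, y, u] \<in> S ?R \<longrightarrow> u = z)" by simp
  then obtain z' where z': "[x, y, z'] \<in> S ?R" "\<And>u. [x, y, u] \<in> S ?R \<Longrightarrow> u = z'" by auto
  have "star2 S F x y = z'" unfolding star2_def using z'(1) by (rule the_equality) (rule z'(2))
  then show ?thesis using z'(1) by (simp only:) (rule iffI, erule z'(2), simp only:)
qed

lemma sat_star [simp]:
  "sat S v (Fun1 F x y) \<longleftrightarrow> v y = star1 S F (v x)"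
  "sat S v (Fun2 G x y z) \<longleftrightarrow> v z = star2 S G (v x) (v y)"
  by (simp_all only: Fun1_def Fun2_def sat.simps list.map star1_iff star2_iff)

lemma star_rel_conj: "star_rel S (\<lambda>a b. P a b \<and> Q a b) x y \<longleftrightarrow> star_rel S P x y \<and> star_rel S Q x y"
proof -
  have "sat (\<lambda>R. R) v (Forall 0 (Forall 1 (Iff (Rel2 (\<lambda>a b. P a b \<and> Q a b) 0 1) (Conj (Rel2 P 0 1) (Rel2 Q 0 1)))))" for v
    by simp
  from transfer[OF this] show ?thesis by simp
qed

lemma star_rel_not: "star_rel S (\<lambda>a b. \<not> P a b) x y \<longleftrightarrow> \<not> star_rel S P x y"
proof -
  have "sat (\<lambda>R. R) v (Forall 0 (Forall 1 (Iff (Rel2 (\<lambda>a b. \<not> P a b) 0 1) (Neg (Rel2 P 0 1)))))" for v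
    by simp
  from transfer[OF this] show ?thesis by simp
qed

lemma star_rel_True: "star_rel S (\<lambda>a b. True) x y"
proof -
  have "sat (\<lambda>R. R) v (Forall 0 (Forall 1 (Rel2 (\<lambda>a b. True) 0 1)))" for v
    by simp
  from transfer[OF this] show ?thesis by simp
qed

lemma star_rel_mono:
  assumes "star_rel S P x y" "\<And>a b. P a b \<Longrightarrow> Q a b"
  shows "star_rel S Q x y"
proof -
  have "sat (\<lambda>R. R) v (Forall 0 (Forall 1 (Imp (Rel2 P 0 1) (Rel2 Q 0 1))))" for v
    using assms(2) by simp
  from transfer[OF this] show ?thesis using assms(1) by simp
qed

text \<open>Extension commutes with finite conjunctions, by induction from the binary case; this is
  used for the coordinates of a grid point.\<close>

lemma star_rel_finite_Ball:
  assumes "finite I"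
  shows "star_rel S (\<lambda>a b. \<forall>i\<in>I. P i a b) x y \<longleftrightarrow> (\<forall>i\<in>I. star_rel S (P i) x y)"
  using assms by (induction I) (simp_all add: star_rel_True star_rel_conj)

text \<open>In the language of model theory, the complete type of the pair over the full standard
  structure.\<close>

definition type_filter :: "'w \<Rightarrow> 'w \<Rightarrow> ('n universe \<times> 'n universe) filter" where
  "type_filter x y = Abs_filter (\<lambda>P. star_rel S (\<lambda>a b. P (a, b)) x y)"

lemma eventually_type_filter:
  "eventually P (type_filter x y) \<longleftrightarrow> star_rel S (\<lambda>a b. P (a, b)) x y"
  unfolding type_filter_def
proof (rule eventually_Abs_filter)
  show "is_filter (\<lambda>P. star_rel S (\<lambda>a b. P (a, b)) x y)"
    by standard (auto simp: star_rel_True star_rel_conj elim: star_rel_mono)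
qed

lemma is_ultrafilter_type_filter: "is_ultrafilter (type_filter x y)"
  unfolding is_ultrafilter_def
proof (intro conjI allI)
  show "type_filter x y \<noteq> bot"
    unfolding trivial_limit_def eventually_type_filter
    using star_rel_not[of "\<lambda>_ _. True" x y] star_rel_True by simp
  show "eventually P (type_filter x y) \<or> eventually (\<lambda>i. \<not> P i) (type_filter x y)" for P
    unfolding eventually_type_filter by (simp add: star_rel_not)
qed

text \<open>The analogue of the theorem of Los for inequalities: comparing the extended function
  with a standard real is largeness of a standard relation.\<close>

lemma hle_star2:
  fixes H :: "'n universe \<Rightarrow> 'n universe \<Rightarrow> real"
  shows "hle S (e (num r)) (star2 S (\<lambda>a b. num (H a b)) x y) \<longleftrightarrow> star_rel S (\<lambda>a b. r \<le> H a b) x y"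
    and "hle S (star2 S (\<lambda>a b. num (H a b)) x y) (e (num r)) \<longleftrightarrow> star_rel S (\<lambda>a b. H a b \<le> r) x y"
proof -
  let ?L = "\<lambda>a b. \<exists>r s. a = num r \<and> b = num s \<and> r \<le> s"
  \<comment> \<open>Variable 3 stays free and is valued \<open>num r\<close>, so transfer puts
    \<open>e (num r)\<close> in its place.\<close>
  have "sat (\<lambda>R. R) (\<lambda>_. num r) (Forall 0 (Forall 1 (Forall 2 (Imp (Fun2 (\<lambda>a b. num (H a b)) 0 1 2)
     (Iff (Rel2 ?L 3 2) (Rel2 (\<lambda>a b. r \<le> H a b) 0 1))))))"
    by simp
  from transfer[OF this]
  show "hle S (e (num r)) (star2 S (\<lambda>a b. num (H a b)) x y) \<longleftrightarrow> star_rel S (\<lambda>a b. r \<le> H a b) x y"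
    by (simp add: hle_def)
  have "sat (\<lambda>R. R) (\<lambda>_. num r) (Forall 0 (Forall 1 (Forall 2 (Imp (Fun2 (\<lambda>a b. num (H a b)) 0 1 2)
     (Iff (Rel2 ?L 2 3) (Rel2 (\<lambda>a b. H a b \<le> r) 0 1))))))"
    by simp
  from transfer[OF this]
  show "hle S (star2 S (\<lambda>a b. num (H a b)) x y) (e (num r)) \<longleftrightarrow> star_rel S (\<lambda>a b. H a b \<le> r) x y"
    by (simp add: hle_def)
qed

lemma star2_in_hyperreals: "star2 S (\<lambda>a b. num (H a b)) x y \<in> hyperreals S"
proof -
  have "sat (\<lambda>R. R) v (Forall 0 (Forall 1 (Forall 2 (Imp (Fun2 (\<lambda>a b. num (H a b)) 0 1 2) (In (range num) 2)))))" for v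
    by simp
  from transfer[OF this] show ?thesis by (simp add: hyperreals_def)
qed

text \<open>Being within every standard \<delta> of \<open>r\<close> and converging to
  \<open>r\<close> along the ultrafilter are the same condition; limits are unique because the
  filter is proper.\<close>

lemma standard_part_eq_limit:
  fixes H :: "'n universe \<Rightarrow> 'n universe \<Rightarrow> real"
  assumes L: "((\<lambda>(a, b). H a b) \<longlongrightarrow> L) (type_filter x y)"
  defines "h \<equiv> star2 S (\<lambda>a b. num (H a b)) x y"
  shows "hfinite e S h" and "std_part e S h = L"
proof -
  let ?F = "type_filter x y"
  have near_iff: "(\<forall>\<delta>>0. hle S (e (num (r - \<delta>))) h \<and> hle S h (e (num (r + \<delta>)))) \<longleftrightarrow>
    ((\<lambda>(a, b). H a b) \<longlongrightarrow> r) ?F" for r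
  proof
    assume A: "\<forall>\<delta>>0. hle S (e (num (r - \<delta>))) h \<and> hle S h (e (num (r + \<delta>)))"
    show "((\<lambda>(a, b). H a b) \<longlongrightarrow> r) ?F"
    proof (rule tendstoI)
      fix d :: real assume d: "d > 0"
      \<comment> \<open>The comparisons are not strict; half the radius gives the strict bound that
        \<open>tendstoI\<close> wants.\<close>
      then have "hle S (e (num (r - d / 2))) h \<and> hle S h (e (num (r + d / 2)))" using A by simp
      then have "eventually (\<lambda>(a, b). r - d / 2 \<le> H a b \<and> H a b \<le> r + d / 2) ?F"
        unfolding h_def hle_star2 eventually_type_filter by (simp add: star_rel_conj)
      then show "eventually (\<lambda>i. dist (case i of (a, b) \<Rightarrow> H a b) r < d) ?F"
        by (rule eventually_mono) (use d in \<open>auto simp: dist_real_def abs_less_iff\<close>)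
    qed
  next
    assume A: "((\<lambda>(a, b). H a b) \<longlongrightarrow> r) ?F"
    show "\<forall>\<delta>>0. hle S (e (num (r - \<delta>))) h \<and> hle S h (e (num (r + \<delta>)))"
    proof (intro allI impI)
      fix \<delta> :: real assume "\<delta> > 0"
      from tendstoD[OF A this]
      have "star_rel S (\<lambda>a b. dist (H a b) r < \<delta>) x y" unfolding eventually_type_filter by simp
      then have "star_rel S (\<lambda>a b. r - \<delta> \<le> H a b \<and> H a b \<le> r + \<delta>) x y"
        by (rule star_rel_mono) (auto simp: dist_real_def)
      then show "hle S (e (num (r - \<delta>))) h \<and> hle S h (e (num (r + \<delta>)))"
        unfolding h_def hle_star2 star_rel_conj .
    qed
  qed
  show "std_part e S h = L"
    unfolding std_part_def near_iff
  proof (rule the_equality)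
    show "r = L" if "((\<lambda>(a, b). H a b) \<longlongrightarrow> r) ?F" for r
      using tendsto_unique[OF _ that L] is_ultrafilter_type_filter[of x y] by (simp add: is_ultrafilter_def)
  qed (rule L)
  show "hfinite e S h"
    unfolding hfinite_def
  proof (intro conjI exI)
    show "h \<in> hyperreals S" unfolding h_def by (rule star2_in_hyperreals)
    let ?r = "\<bar>L\<bar> + 1"
    have "hle S (e (num (L - 1))) h \<and> hle S h (e (num (L + 1)))" by (rule iffD2[OF near_iff L, rule_format]) simp
    then have *: "star_rel S (\<lambda>a b. L - 1 \<le> H a b) x y" "star_rel S (\<lambda>a b. H a b \<le> L + 1) x y"
      unfolding h_def hle_star2 by auto
    show "hle S (e (num (- ?r))) h" unfolding h_def hle_star2
      by (rule star_rel_mono[OF *(1)]) linarith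
    show "hle S h (e (num ?r))" unfolding h_def hle_star2
      by (rule star_rel_mono[OF *(2)]) linarith
  qed
qed

end

section \<open>Internal graphs\<close>

text \<open>The argument is the number before the factorial is taken; the extension of this function
  sends \<open>N0\<close> to \<open>grid_eps S N0\<close>.\<close>

definition grid_mesh :: "real \<Rightarrow> real" where
  "grid_mesh r = 1 / fact (nat \<lfloor>r\<rfloor>)"

definition std_grid :: "real \<Rightarrow> real set" where
  "std_grid r = {m * grid_mesh r | m. m \<in> \<int> \<and> - ((fact (nat \<lfloor>r\<rfloor>))\<^sup>2) \<le> m \<and> m \<le> (fact (nat \<lfloor>r\<rfloor>))\<^sup>2}"

definition std_grid_dom :: "(real ^ ('n::finite)) set \<Rightarrow> real \<Rightarrow> (real ^ 'n) set" where
  "std_grid_dom \<Omega> r = {p \<in> \<Omega>. \<forall>i. p $ i \<in> std_grid r}"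

definition graph_on :: "(real ^ ('n::finite)) set \<Rightarrow> 'n universe \<Rightarrow> bool" where
  "graph_on D b \<longleftrightarrow>
    (\<forall>q. mem q b \<longrightarrow> (\<exists>p\<in>D. \<exists>r. q = opair (pnt p) (num r))) \<and>
    (\<forall>p\<in>D. \<exists>!r. mem (opair (pnt p) (num r)) b)"

definition graph_fun :: "('n::finite) universe \<Rightarrow> real ^ 'n \<Rightarrow> real" where
  "graph_fun b p = (THE r. mem (opair (pnt p) (num r)) b)"

text \<open>Its extension takes the internal graph of \<open>f\<close> to that of the summand of the
  pairing, which exhibits the summand as internal. The elements are raw pairs in
  \<open>V\<^sub>4\<close>, as \<open>St\<close> requires; their images under \<open>incl\<close>
  are the ordered pairs.\<close>

definition weight_graph ::
    "(real \<Rightarrow> real) \<Rightarrow> (real ^ ('n::finite) \<Rightarrow> real) \<Rightarrow> 'n universe \<Rightarrow> 'n universe" where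
  "weight_graph \<Psi> \<phi> b = St {Pr (Ur (Point p)) (Ur (Scalar (\<Psi> r * \<phi> p))) | p r. mem (opair (pnt p) (num r)) b}"

lemma finite_std_grid: "finite (std_grid r)"
proof -
  let ?N = "fact (nat \<lfloor>r\<rfloor>) :: int"
  have "std_grid r \<subseteq> (\<lambda>m. of_int m * grid_mesh r) ` {- (?N\<^sup>2)..?N\<^sup>2}"
  proof
    fix t assume "t \<in> std_grid r"
    then obtain m :: int where m: "t = of_int m * grid_mesh r" "- ((fact (nat \<lfloor>r\<rfloor>))\<^sup>2) \<le> real_of_int m"
      "real_of_int m \<le> (fact (nat \<lfloor>r\<rfloor>))\<^sup>2"
      by (auto simp: std_grid_def elim!: Ints_cases)
    have "real_of_int (- (?N\<^sup>2)) \<le> real_of_int m" "real_of_int m \<le> real_of_int (?N\<^sup>2)"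
      using m by simp_all
    then have "m \<in> {- (?N\<^sup>2)..?N\<^sup>2}" by (simp only: of_int_le_iff atLeastAtMost_iff)
    then show "t \<in> (\<lambda>m. of_int m * grid_mesh r) ` {- (?N\<^sup>2)..?N\<^sup>2}" using m(1) by blast
  qed
  then show ?thesis by (rule finite_subset) simp
qed

lemma finite_std_grid_dom: "finite (std_grid_dom \<Omega> r :: (real ^ 'n::finite) set)"
proof (rule finite_subset)
  show "std_grid_dom \<Omega> r \<subseteq> (\<lambda>f. \<chi> i. f i) ` (UNIV \<rightarrow>\<^sub>E std_grid r)"
  proof
    fix p assume "p \<in> std_grid_dom \<Omega> r"
    then have "(\<lambda>i. p $ i) \<in> UNIV \<rightarrow>\<^sub>E std_grid r" by (auto simp: std_grid_dom_def)
    moreover have "p = (\<chi> i. p $ i)" by simp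
    ultimately show "p \<in> (\<lambda>f. \<chi> i. f i) ` (UNIV \<rightarrow>\<^sub>E std_grid r)" by blast
  qed
  show "finite ((\<lambda>f. \<chi> i. f i) ` (UNIV \<rightarrow>\<^sub>E std_grid r) :: (real ^ 'n) set)"
    by (intro finite_imageI finite_PiE) (auto simp: finite_std_grid)
qed

lemma grid_mesh_pos: "0 < grid_mesh r"
  by (simp add: grid_mesh_def)

lemma std_grid_separated:
  assumes "s \<in> std_grid r" "t \<in> std_grid r" "\<bar>s - t\<bar> < grid_mesh r"
  shows "s = t"
proof -
  obtain a b :: int where ab: "s = of_int a * grid_mesh r" "t = of_int b * grid_mesh r"
    using assms(1,2) by (auto simp: std_grid_def elim!: Ints_cases)
  then have "\<bar>of_int (a - b)\<bar> * grid_mesh r < 1 * grid_mesh r"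
    using assms(3) grid_mesh_pos[of r] by (simp add: left_diff_distrib[symmetric] abs_mult)
  then have "\<bar>real_of_int (a - b)\<bar> < 1"
    using grid_mesh_pos[of r] by (simp only: mult_less_cancel_right_pos)
  then have "a = b" by linarith
  then show ?thesis using ab by simp
qed

lemma mem_weight_graph:
  "mem q (weight_graph \<Psi> \<phi> b) \<longleftrightarrow>
    (\<exists>p r. mem (opair (pnt p) (num r)) b \<and> q = opair (pnt p) (num (\<Psi> r * \<phi> p)))"
proof -
  have "mem q (weight_graph \<Psi> \<phi> b) \<longleftrightarrow> (\<exists>p r. mem (opair (pnt p) (num r)) b \<and>
      q = incl (Pr (Ur (Point p)) (Ur (Scalar (\<Psi> r * \<phi> p)))))"
    unfolding mem_def[of q] weight_graph_def by auto
  also have "\<dots> \<longleftrightarrow> (\<exists>p r. mem (opair (pnt p) (num r)) b \<and> q = opair (pnt p) (num (\<Psi> r * \<phi> p)))"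
    by (simp add: incl_def opair_pnt_num)
  finally show ?thesis .
qed

lemma opair_eq_iff: "opair (pnt p) (num r) = opair (pnt q) (num s) \<longleftrightarrow> p = q \<and> r = s"
  by (simp add: opair_pnt_num)

text \<open>The hypothesis has the shape that simplification gives to the first-order description of
  graphs used for transfer.\<close>

lemma graph_onI:
  assumes "(\<forall>q. mem q b \<longrightarrow> (\<exists>x. (\<exists>p\<in>D. x = pnt p) \<and> (\<exists>r. q = opair x (num r)))) \<and>
    (\<forall>x. (\<exists>p\<in>D. x = pnt p) \<longrightarrow>
      (\<exists>r. mem (opair x (num r)) b \<and> (\<forall>y. y \<in> range num \<and> mem (opair x y) b \<longrightarrow> y = num r)))"
  shows "graph_on D b"
  unfolding graph_on_def
proof (intro conjI allI impI ballI)
  fix q assume "mem q b"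
  then have "\<exists>x. (\<exists>p\<in>D. x = pnt p) \<and> (\<exists>r. q = opair x (num r))"
    using spec[OF conjunct1[OF assms], of q] by (rule mp[rotated])
  then obtain p r where "p \<in> D" "q = opair (pnt p) (num r)" by (elim exE bexE conjE) simp
  then show "\<exists>p\<in>D. \<exists>r. q = opair (pnt p) (num r)" by (intro bexI[of _ p] exI[of _ r])
next
  fix p assume "p \<in> D"
  then have "\<exists>p'\<in>D. pnt p = pnt p'" by auto
  then have "\<exists>r. mem (opair (pnt p) (num r)) b \<and> (\<forall>y. y \<in> range num \<and> mem (opair (pnt p) y) b \<longrightarrow> y = num r)"
    using spec[OF conjunct2[OF assms], of "pnt p"] by (rule mp[rotated])
  then obtain r where r: "mem (opair (pnt p) (num r)) b"
    and u: "\<forall>y. y \<in> range num \<and> mem (opair (pnt p) y) b \<longrightarrow> y = num r" by auto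
  show "\<exists>!r. mem (opair (pnt p) (num r)) b"
  proof (rule ex1I)
    show "mem (opair (pnt p) (num r)) b" by (rule r)
    fix s assume "mem (opair (pnt p) (num s)) b"
    then have "num s = num r" using spec[OF u, of "num s"] by simp
    then show "s = r" by (simp only: num_eq_iff)
  qed
qed

lemma graph_sum_weight_graph:
  assumes "graph_on D b"
  shows "graph_sum (weight_graph \<Psi> \<phi> b) = (\<Sum>p\<in>D. \<Psi> (graph_fun b p) * \<phi> p)"
proof -
  note G = assms[unfolded graph_on_def]
  have g: "mem (opair (pnt p) (num r)) b \<longleftrightarrow> p \<in> D \<and> r = graph_fun b p" for p r
  proof
    assume m: "mem (opair (pnt p) (num r)) b"
    then have "\<exists>p'\<in>D. \<exists>r'. opair (pnt p) (num r) = opair (pnt p') (num r')"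
      using spec[OF conjunct1[OF G], of "opair (pnt p) (num r)"] by (rule mp[rotated])
    then have "p \<in> D" by (elim bexE exE) (simp add: opair_eq_iff)
    moreover have "\<exists>!r. mem (opair (pnt p) (num r)) b" by (rule bspec[OF conjunct2[OF G] \<open>p \<in> D\<close>])
    then have "graph_fun b p = r" unfolding graph_fun_def by (rule the1_equality) (rule m)
    ultimately show "p \<in> D \<and> r = graph_fun b p" by simp
  next
    assume pr: "p \<in> D \<and> r = graph_fun b p"
    then have "\<exists>!r. mem (opair (pnt p) (num r)) b" by (intro bspec[OF conjunct2[OF G]]) simp
    from theI'[OF this] show "mem (opair (pnt p) (num r)) b" using pr by (simp add: graph_fun_def)
  qed
  have "{q. mem q (weight_graph \<Psi> \<phi> b)} = (\<lambda>p. opair (pnt p) (num (\<Psi> (graph_fun b p) * \<phi> p))) ` D"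
    unfolding mem_weight_graph g by auto
  \<comment> \<open>The first component separates the pairs even where values coincide, so the sum
    over the graph counts each point of \<open>D\<close> once.\<close>
  moreover have "inj_on (\<lambda>p. opair (pnt p) (num (\<Psi> (graph_fun b p) * \<phi> p))) D"
    by (rule inj_onI) (simp add: opair_eq_iff)
  ultimately show ?thesis
    unfolding graph_sum_def by (simp add: sum.reindex opair_pnt_num incl_def)
qed

lemma sets_extensional:
  assumes "b \<in> range St \<and> c \<in> range St \<and> (\<forall>p. mem p b = mem p c)"
  shows "b = c"
proof -
  obtain A B where AB: "b = St A" "c = St B" using assms by auto
  have "A = B" by (rule mem_St_extensional) (use assms AB in simp)
  then show ?thesis using AB by simp
qed

section \<open>The hyperfinite grid, internal graphs and the pairing as extensions of standard
  objects\<close>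

context nonstandard
begin

lemma hle_eq: "hle S = star_rel S (\<lambda>a b. \<exists>r s. a = num r \<and> b = num s \<and> r \<le> s)"
  by (simp add: hle_def fun_eq_iff)

lemma mem_grid_iff: "t \<in> grid S N0 \<longleftrightarrow> star_rel S (\<lambda>a t. \<exists>r. t = num r \<and> r \<in> std_grid (val a)) N0 t"
proof -
  let ?le = "\<lambda>a b :: 'n universe. \<exists>r s. a = num r \<and> b = num s \<and> r \<le> s"
  have *: "(\<exists>r. t = num r \<and> r \<in> std_grid (val a)) \<longleftrightarrow>
    (\<exists>m. m \<in> \<int> \<and> - (fact (nat \<lfloor>val a\<rfloor>))\<^sup>2 \<le> m \<and> m \<le> (fact (nat \<lfloor>val a\<rfloor>))\<^sup>2 \<and>
       t = num (m / fact (nat \<lfloor>val a\<rfloor>)))" for a t :: "'n universe"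
    by (auto simp: std_grid_def grid_mesh_def)
  \<comment> \<open>Variables: 0 is \<open>N0\<close>, 1 the grid coordinate, 2 the integer
    multiple, 3 is \<open>N\<close>, 4 the mesh \<open>1 / N\<close>, 5 and 6 the bounds
    \<open>- N^2\<close> and \<open>N^2\<close>.\<close>
  have "sat (\<lambda>R. R) v (Forall 0 (Forall 1 (Iff (Rel2 (\<lambda>a t. \<exists>r. t = num r \<and> r \<in> std_grid (val a)) 0 1)
    (Exists 2 (Exists 3 (Exists 4 (Exists 5 (Exists 6 (Conj (Fun1 (\<lambda>a. num (fact (nat \<lfloor>val a\<rfloor>))) 0 3)
      (Conj (Fun1 (\<lambda>a. num (1 / val a)) 3 4) (Conj (Fun1 (\<lambda>a. num (- ((val a)\<^sup>2))) 3 5)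
      (Conj (Fun1 (\<lambda>a. num ((val a)\<^sup>2)) 3 6) (Conj (In (num ` \<int>) 2) (Conj (Rel2 ?le 5 2) (Conj (Rel2 ?le 2 6)
      (Fun2 (\<lambda>a b. num (val a * val b)) 2 4 1))))))))))))))))" for v :: "nat \<Rightarrow> 'n universe"
    by (simp add: * Bex_def)
  from transfer[OF this] have "star_rel S (\<lambda>a t. \<exists>r. t = num r \<and> r \<in> std_grid (val a)) N0 t \<longleftrightarrow>
    (\<exists>n. n \<in> star_set S (num ` \<int>) \<and>
       hle S (hfun1 S (\<lambda>r. - (r ^ 2)) (grid_N S N0)) n \<and>
       hle S n (hfun1 S (\<lambda>r. r ^ 2) (grid_N S N0)) \<and> t = hfun2 S (*) n (grid_eps S N0))"
    by (simp add: hle_eq hfun1_def hfun2_def grid_N_def grid_eps_def)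
  then show ?thesis unfolding grid_def by auto
qed

lemma mem_grid_dom_iff:
  "x \<in> grid_dom S N0 \<Omega> \<longleftrightarrow> star_rel S (\<lambda>a x. \<exists>p\<in>std_grid_dom \<Omega> (val a). x = pnt p) N0 x"
proof -
  let ?G = "\<lambda>a t. \<exists>r. t = num r \<and> r \<in> std_grid (val a)"
  let ?C = "\<lambda>i a x. vec_val x $ i \<in> std_grid (val a)"
  have "hpfun S (\<lambda>p. p $ i) x \<in> grid S N0 \<longleftrightarrow> star_rel S (?C i) N0 x" for i
  proof -
    have "sat (\<lambda>R. R) v (Forall 0 (Forall 1 (Forall 2 (Imp (Fun1 (\<lambda>a. num (vec_val a $ i)) 1 2)
      (Iff (Rel2 ?G 0 2) (Rel2 (?C i) 0 1))))))" for v :: "nat \<Rightarrow> 'n universe"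
      by simp
    from transfer[OF this] show ?thesis by (simp add: mem_grid_iff hpfun_def)
  qed
  then have "(\<forall>i. hpfun S (\<lambda>p. p $ i) x \<in> grid S N0) \<longleftrightarrow> star_rel S (\<lambda>a x. \<forall>i\<in>UNIV. ?C i a x) N0 x"
    by (subst star_rel_finite_Ball) simp_all
  moreover have "star_rel S (\<lambda>a x. \<exists>p\<in>std_grid_dom \<Omega> (val a). x = pnt p) N0 x \<longleftrightarrow>
    x \<in> star_set S (pnt ` \<Omega>) \<and> star_rel S (\<lambda>a x. \<forall>i\<in>UNIV. ?C i a x) N0 x"
  proof -
    have "sat (\<lambda>R. R) v (Forall 0 (Forall 1 (Iff (Rel2 (\<lambda>a x. \<exists>p\<in>std_grid_dom \<Omega> (val a). x = pnt p) 0 1)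
      (Conj (In (pnt ` \<Omega>) 1) (Rel2 (\<lambda>a x. \<forall>i\<in>UNIV. ?C i a x) 0 1)))))" for v :: "nat \<Rightarrow> 'n universe"
      by (auto simp: std_grid_dom_def)
    from transfer[OF this] show ?thesis by simp
  qed
  ultimately show ?thesis unfolding grid_dom_def by simp
qed

lemma grid_dom_subset_points: "x \<in> grid_dom S N0 \<Omega> \<Longrightarrow> x \<in> star_set S (range pnt)"
proof -
  have "sat (\<lambda>R. R) v (Forall 0 (Forall 1 (Imp (Rel2 (\<lambda>a x. \<exists>p\<in>std_grid_dom \<Omega> (val a). x = pnt p) 0 1)
    (In (range pnt) 1))))" for v :: "nat \<Rightarrow> 'n universe"
    by auto
  from transfer[OF this] show "x \<in> grid_dom S N0 \<Omega> \<Longrightarrow> x \<in> star_set S (range pnt)"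
    by (simp add: mem_grid_dom_iff)
qed

text \<open>Stated for points and hyperreals because the definite description in
  \<open>opair\<close> is evaluated on urelements, where injectivity is available for
  transfer.\<close>

lemma star_opair_inject:
  assumes "x \<in> star_set S (range pnt)" "x' \<in> star_set S (range pnt)" "y \<in> hyperreals S" "y' \<in> hyperreals S"
    and "star2 S opair x y = star2 S opair x' y'"
  shows "x = x' \<and> y = y'"
proof -
  have "sat (\<lambda>R. R) v (Forall 0 (Forall 1 (Forall 2 (Forall 3 (Forall 4 (Imp (Conj (In (range pnt) 0)
    (Conj (In (range pnt) 1) (Conj (In (range num) 2) (Conj (In (range num) 3) (Conj (Fun2 opair 0 2 4) (Fun2 opair 1 3 4))))))
    (Conj (Equal 0 1) (Equal 2 3))))))))" for v :: "nat \<Rightarrow> 'n universe"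
    by (auto simp: opair_eq_iff)
  note T = transfer[OF this, simplified, rule_format]
  show ?thesis by (rule T) (use assms in \<open>simp add: hyperreals_def\<close>)
qed

text \<open>Urelements and pairs have no members, just like the empty set, so extensionality is
  confined to the extension of \<open>range St\<close>. It makes the description in
  \<open>hsum\<close> unambiguous.\<close>

lemma internal_set_extensional:
  assumes "b \<in> star_set S (range St)" "c \<in> star_set S (range St)"
    and "\<And>p. star_rel S mem p b \<longleftrightarrow> star_rel S mem p c"
  shows "b = c"
proof -
  have "sat (\<lambda>R. R) v (Forall 0 (Forall 1 (Imp (Conj (In (range St) 0) (Conj (In (range St) 1)
    (Forall 2 (Iff (Rel2 mem 2 0) (Rel2 mem 2 1))))) (Equal 0 1))))" for v :: "nat \<Rightarrow> 'n universe"
    by (simp, intro allI impI, rule sets_extensional)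
  note T = transfer[OF this, simplified, rule_format]
  show ?thesis by (rule T) (use assms in simp)
qed

lemma star_mem_weight_graph:
  "star_rel S mem q (star1 S (weight_graph \<Psi> \<phi>) b) \<longleftrightarrow>
    (\<exists>x y. x \<in> star_set S (range pnt) \<and> y \<in> hyperreals S \<and> star_rel S mem (star2 S opair x y) b \<and>
       q = star2 S opair x (hfun2 S (*) (hfun1 S \<Psi> y) (hpfun S \<phi> x)))"
proof -
  \<comment> \<open>Variables: 0 and 1 are the graph and the weighted graph, 2 the member, 3 and 4 a
    point and its value, 5 their pair, 6 to 8 the two factors and their product.\<close>
  have "sat (\<lambda>R. R) v (Forall 0 (Forall 1 (Forall 2 (Imp (Fun1 (weight_graph \<Psi> \<phi>) 0 1) (Iff (Rel2 mem 2 1)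
    (Exists 3 (Exists 4 (Exists 5 (Exists 6 (Exists 7 (Exists 8 (Conj (In (range pnt) 3) (Conj (In (range num) 4)
      (Conj (Fun2 opair 3 4 5) (Conj (Rel2 mem 5 0) (Conj (Fun1 (\<lambda>a. num (\<Psi> (val a))) 4 6)
      (Conj (Fun1 (\<lambda>a. num (\<phi> (vec_val a))) 3 7) (Conj (Fun2 (\<lambda>a b. num (val a * val b)) 6 7 8)
      (Fun2 opair 3 8 2)))))))))))))))))))" for v :: "nat \<Rightarrow> 'n universe"
    by (auto simp: mem_weight_graph)
  from transfer[OF this] show ?thesis by (simp add: hyperreals_def hfun1_def hfun2_def hpfun_def)
qed

lemma weight_graph_is_set: "star1 S (weight_graph \<Psi> \<phi>) b \<in> star_set S (range St)"
proof -
  have "sat (\<lambda>R. R) v (Forall 0 (Forall 1 (Imp (Fun1 (weight_graph \<Psi> \<phi>) 0 1) (In (range St) 1))))"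
    for v :: "nat \<Rightarrow> 'n universe"
    by (simp add: weight_graph_def)
  from transfer[OF this] show ?thesis by simp
qed

lemma grid_function_hyperreal:
  assumes "f \<in> grid_functions S N0 \<Omega>" "x \<in> grid_dom S N0 \<Omega>"
  shows "f x \<in> hyperreals S"
proof -
  have "f \<in> grid_dom S N0 \<Omega> \<rightarrow>\<^sub>E hyperreals S" using assms(1) by (simp only: grid_functions_def mem_Collect_eq)
  then show ?thesis by (rule PiE_mem) (rule assms(2))
qed

lemma internal_graph:
  assumes f: "f \<in> grid_functions S N0 \<Omega>" and b: "hgraph S (grid_dom S N0 \<Omega>) f = {q. star_rel S mem q b}"
  shows star_mem_graph: "star_rel S mem q b \<longleftrightarrow> (\<exists>x\<in>grid_dom S N0 \<Omega>. q = star2 S opair x (f x))"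
    and star_mem_graph_opair: "x \<in> star_set S (range pnt) \<Longrightarrow> y \<in> hyperreals S \<Longrightarrow>
      star_rel S mem (star2 S opair x y) b \<longleftrightarrow> x \<in> grid_dom S N0 \<Omega> \<and> y = f x"
proof -
  have fh: "f x \<in> hyperreals S" if "x \<in> grid_dom S N0 \<Omega>" for x
    by (rule grid_function_hyperreal[OF f that])
  have "q \<in> {q. star_rel S mem q b} \<longleftrightarrow> (\<exists>x\<in>grid_dom S N0 \<Omega>. q = star2 S opair x (f x))" for q
    unfolding b[symmetric] hgraph_def by auto
  then show m: "star_rel S mem q b \<longleftrightarrow> (\<exists>x\<in>grid_dom S N0 \<Omega>. q = star2 S opair x (f x))" for q by simp
  show "star_rel S mem (star2 S opair x y) b \<longleftrightarrow> x \<in> grid_dom S N0 \<Omega> \<and> y = f x"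
    if "x \<in> star_set S (range pnt)" "y \<in> hyperreals S"
    unfolding m
  proof
    assume "\<exists>x'\<in>grid_dom S N0 \<Omega>. star2 S opair x y = star2 S opair x' (f x')"
    then obtain x' where x': "x' \<in> grid_dom S N0 \<Omega>" "star2 S opair x y = star2 S opair x' (f x')" ..
    from star_opair_inject[OF that(1) grid_dom_subset_points[OF x'(1)] that(2) fh[OF x'(1)] x'(2)]
    show "x \<in> grid_dom S N0 \<Omega> \<and> y = f x" using x'(1) by simp
  qed auto
qed

text \<open>Being a graph over the grid is expressible by membership, pairing and the grid relation.
  Hence this property of the internal \<open>b\<close> is a large standard relation, and almost
  every standard pair carries an actual grid function.\<close>

lemma star_graph_on:
  assumes f: "f \<in> grid_functions S N0 \<Omega>" and b: "hgraph S (grid_dom S N0 \<Omega>) f = {q. star_rel S mem q b}"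
  shows "star_rel S (\<lambda>b a. graph_on (std_grid_dom \<Omega> (val a)) b) b N0"
proof -
  let ?D = "\<lambda>a x. \<exists>p\<in>std_grid_dom \<Omega> (val a). x = pnt p"
  have fh: "f x \<in> hyperreals S" if "x \<in> grid_dom S N0 \<Omega>" for x
    by (rule grid_function_hyperreal[OF f that])
  \<comment> \<open>Variables: 0 is \<open>b\<close>, 1 is \<open>N0\<close>, 2 a pair, 3 a grid
    point, 4 its value and 5 a competing value.\<close>
  have "sat (\<lambda>R. R) v (Forall 0 (Forall 1 (Imp
    (Conj (Forall 2 (Imp (Rel2 mem 2 0) (Exists 3 (Exists 4 (Conj (Rel2 ?D 1 3) (Conj (In (range num) 4) (Fun2 opair 3 4 2)))))))
      (Forall 3 (Imp (Rel2 ?D 1 3) (Exists 4 (Conj (Conj (In (range num) 4) (Exists 2 (Conj (Fun2 opair 3 4 2) (Rel2 mem 2 0))))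
         (Forall 5 (Imp (Conj (In (range num) 5) (Exists 2 (Conj (Fun2 opair 3 5 2) (Rel2 mem 2 0)))) (Equal 5 4))))))))
    (Rel2 (\<lambda>b a. graph_on (std_grid_dom \<Omega> (val a)) b) 0 1))))" for v :: "nat \<Rightarrow> 'n universe"
    by (simp, intro allI impI, rule graph_onI, assumption)
  from transfer[OF this] have main: "\<lbrakk>\<forall>q. star_rel S mem q b \<longrightarrow> (\<exists>x y. star_rel S ?D N0 x \<and> y \<in> hyperreals S \<and> q = star2 S opair x y);
    \<forall>x. star_rel S ?D N0 x \<longrightarrow> (\<exists>y. (y \<in> hyperreals S \<and> star_rel S mem (star2 S opair x y) b) \<and>
      (\<forall>y'. y' \<in> hyperreals S \<and> star_rel S mem (star2 S opair x y') b \<longrightarrow> y' = y))\<rbrakk> \<Longrightarrow>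
    star_rel S (\<lambda>b a. graph_on (std_grid_dom \<Omega> (val a)) b) b N0"
    by (simp add: hyperreals_def)
  show ?thesis
  proof (rule main; unfold mem_grid_dom_iff[symmetric]; intro allI impI)
    fix q assume "star_rel S mem q b"
    then show "\<exists>x y. x \<in> grid_dom S N0 \<Omega> \<and> y \<in> hyperreals S \<and> q = star2 S opair x y"
      unfolding star_mem_graph[OF f b] using fh by auto
  next
    fix x assume x: "x \<in> grid_dom S N0 \<Omega>"
    note m = star_mem_graph_opair[OF f b grid_dom_subset_points[OF x]]
    show "\<exists>y. (y \<in> hyperreals S \<and> star_rel S mem (star2 S opair x y) b) \<and>
      (\<forall>y'. y' \<in> hyperreals S \<and> star_rel S mem (star2 S opair x y') b \<longrightarrow> y' = y)"
    proof (rule exI[of _ "f x"], intro conjI allI impI)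
      show "f x \<in> hyperreals S" by (rule fh[OF x])
      then show "star_rel S mem (star2 S opair x (f x)) b" using m x by simp
      show "y' = f x" if "y' \<in> hyperreals S \<and> star_rel S mem (star2 S opair x y') b" for y'
        using m[of y'] that by simp
    qed
  qed
qed

text \<open>Once the internal graph of the summand is recognized as the starred
  \<open>weight_graph\<close> of \<open>b\<close>, the hyperfinite sum and the power of the mesh
  compose into one standard function, evaluated at \<open>b\<close> and \<open>N0\<close>.\<close>

lemma pairing_eq_star2:
  assumes f: "f \<in> grid_functions S N0 \<Omega>" and b: "hgraph S (grid_dom S N0 \<Omega>) f = {q. star_rel S mem q b}"
  shows "pairing S N0 \<Omega> (\<lambda>x. hfun1 S \<Psi> (f x)) (hpfun S \<phi>) =
    star2 S (\<lambda>b a. num (grid_mesh (val a) ^ CARD('n) * graph_sum (weight_graph \<Psi> \<phi> b))) b N0"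
proof -
  let ?B = "grid_dom S N0 \<Omega>"
  let ?c = "star1 S (weight_graph \<Psi> \<phi>) b"
  let ?h = "\<lambda>x. hfun2 S (*) (hfun1 S \<Psi> (f x)) (hpfun S \<phi> x)"
  have fh: "f x \<in> hyperreals S" if "x \<in> ?B" for x
    by (rule grid_function_hyperreal[OF f that])
  have "star_rel S mem q ?c \<longleftrightarrow> q \<in> hgraph S ?B ?h" for q
  proof -
    have "star_rel S mem q ?c \<longleftrightarrow> (\<exists>x y. x \<in> star_set S (range pnt) \<and> y \<in> hyperreals S \<and> (x \<in> ?B \<and> y = f x) \<and>
       q = star2 S opair x (hfun2 S (*) (hfun1 S \<Psi> y) (hpfun S \<phi> x)))"
      unfolding star_mem_weight_graph by (simp only: star_mem_graph_opair[OF f b] cong: conj_cong)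
    also have "\<dots> \<longleftrightarrow> q \<in> hgraph S ?B ?h"
    proof
      assume "q \<in> hgraph S ?B ?h"
      then obtain x where "q = star2 S opair x (?h x)" "x \<in> ?B" by (auto simp: hgraph_def)
      then show "\<exists>x y. x \<in> star_set S (range pnt) \<and> y \<in> hyperreals S \<and> (x \<in> ?B \<and> y = f x) \<and>
         q = star2 S opair x (hfun2 S (*) (hfun1 S \<Psi> y) (hpfun S \<phi> x))"
        using grid_dom_subset_points[of x] fh[of x] by (intro exI[of _ x] exI[of _ "f x"]) simp
    qed (auto simp: hgraph_def)
    finally show ?thesis .
  qed
  then have c: "{q. star_rel S mem q ?c} = hgraph S ?B ?h" by auto
  have "(THE b. b \<in> star_set S (range St) \<and> {q. star_rel S mem q b} = hgraph S ?B ?h) = ?c"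
  proof (rule the_equality)
    show "?c \<in> star_set S (range St) \<and> {q. star_rel S mem q ?c} = hgraph S ?B ?h"
      using c weight_graph_is_set by simp
    fix d assume d: "d \<in> star_set S (range St) \<and> {q. star_rel S mem q d} = hgraph S ?B ?h"
    show "d = ?c"
    proof (rule internal_set_extensional)
      show "d \<in> star_set S (range St)" "?c \<in> star_set S (range St)" using d weight_graph_is_set by auto
      have "{q. star_rel S mem q d} = {q. star_rel S mem q ?c}" using c d by simp
      then show "star_rel S mem q d \<longleftrightarrow> star_rel S mem q ?c" for q by blast
    qed
  qed
  then have hs: "hsum S ?B ?h = star1 S (\<lambda>b. num (graph_sum b)) ?c" by (simp add: hsum_def)
  \<comment> \<open>Variables: 0 is \<open>b\<close>, 1 is \<open>N0\<close>, 2 the weighted graph,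
    3 its sum, 4 is \<open>N\<close>, 5 the mesh, 6 its power and 7 the pairing.\<close>
  have "sat (\<lambda>R. R) v (Forall 0 (Forall 1 (Forall 2 (Forall 3 (Forall 4 (Forall 5 (Forall 6 (Forall 7 (Imp
    (Conj (Fun1 (weight_graph \<Psi> \<phi>) 0 2) (Conj (Fun1 (\<lambda>b. num (graph_sum b)) 2 3)
    (Conj (Fun1 (\<lambda>a. num (fact (nat \<lfloor>val a\<rfloor>))) 1 4) (Conj (Fun1 (\<lambda>a. num (1 / val a)) 4 5)
    (Conj (Fun1 (\<lambda>a. num (val a ^ CARD('n))) 5 6) (Fun2 (\<lambda>a b. num (val a * val b)) 6 3 7))))))
    (Fun2 (\<lambda>b a. num (grid_mesh (val a) ^ CARD('n) * graph_sum (weight_graph \<Psi> \<phi> b))) 0 1 7))))))))))"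
    for v :: "nat \<Rightarrow> 'n universe"
    by (simp add: grid_mesh_def)
  from transfer[OF this] show ?thesis
    unfolding pairing_def hs by (simp add: hfun1_def hfun2_def grid_eps_def grid_N_def)
qed

text \<open>A hypernatural number that fails to reach \<open>r\<close> lies between two standard
  reals and would be finite. The first argument \<open>b\<close> only provides the form of relation
  that the ultrafilter tests.\<close>

lemma infinite_hypernat_ge:
  assumes "infinite_hypernat e S N0"
  shows "star_rel S (\<lambda>b a. r \<le> val a) b N0"
proof -
  let ?le = "\<lambda>a b :: 'n universe. \<exists>r s. a = num r \<and> b = num s \<and> r \<le> s"
  have nat: "N0 \<in> star_set S (num ` \<nat>)" and inf: "\<not> hfinite e S N0"
    using assms by (auto simp: infinite_hypernat_def)
  \<comment> \<open>\<open>hfinite\<close> takes one real for both bounds: it must be at least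
    \<open>r\<close> above and nonnegative, so that its negative lies below all natural
    numbers.\<close>
  define R where "R = max r 0"
  have "sat (\<lambda>R. R) (\<lambda>_. num R) (Forall 0 (Imp (In (num ` \<nat>) 0) (Conj (In (range num) 0)
    (Imp (Neg (Forall 1 (Rel2 (\<lambda>b a. r \<le> val a) 1 0))) (Rel2 ?le 0 2)))))"
    by (auto simp: R_def)
  from transfer[OF this] have h: "N0 \<in> hyperreals S"
    and le: "\<not> star_rel S (\<lambda>b a. r \<le> val a) b N0 \<Longrightarrow> hle S N0 (e (num R))"
    using nat by (auto simp: hyperreals_def hle_eq)
  have "sat (\<lambda>R. R) (\<lambda>_. num (- R)) (Forall 0 (Imp (In (num ` \<nat>) 0) (Rel2 ?le 2 0)))"
    by (auto simp: R_def elim!: Nats_cases)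
  from transfer[OF this] have "hle S (e (num (- R))) N0" using nat by (simp add: hle_eq)
  then show ?thesis using le h inf unfolding hfinite_def by blast
qed

end

text \<open>A common point forces every pair of coordinates of the two corners to differ by less
  than the mesh, and distinct multiples of the mesh cannot.\<close>

lemma disjoint_cubes_std_grid:
  fixes \<Omega> :: "(real ^ ('n::finite)) set"
  shows "disjoint_family_on (cube (grid_mesh r)) (std_grid_dom \<Omega> r)"
  unfolding disjoint_family_on_def
proof (intro ballI impI)
  fix p q :: "real ^ 'n" assume pq: "p \<in> std_grid_dom \<Omega> r" "q \<in> std_grid_dom \<Omega> r" "p \<noteq> q"
  show "cube (grid_mesh r) p \<inter> cube (grid_mesh r) q = {}"
  proof (rule ccontr)
    assume "\<not> ?thesis"
    then obtain z where z: "z \<in> cube (grid_mesh r) p" "z \<in> cube (grid_mesh r) q" by auto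
    have "p $ i = q $ i" for i
    proof (rule std_grid_separated)
      show "p $ i \<in> std_grid r" "q $ i \<in> std_grid r" using pq by (simp_all add: std_grid_dom_def)
      define b :: "real ^ 'n" where "b = axis i 1"
      have bB: "b \<in> Basis" by (simp add: b_def axis_in_Basis_iff)
      have in_cube: "x \<bullet> b < z \<bullet> b \<and> z \<bullet> b < x \<bullet> b + grid_mesh r" if "z \<in> cube (grid_mesh r) x" for x
        using that bB by (auto simp: cube_def mem_box inner_left_distrib)
      have "\<bar>p \<bullet> b - q \<bullet> b\<bar> < grid_mesh r"
        using in_cube[OF z(1)] in_cube[OF z(2)] by linarith
      then show "\<bar>p $ i - q $ i\<bar> < grid_mesh r" by (simp add: b_def inner_axis)
    qed
    then have "p = q" by (simp add: vec_eq_iff)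
    then show False using pq(3) by simp
  qed
qed

text \<open>Uses \<open>n \<le> fact n\<close>; the summand 1 pays for rounding \<open>r\<close>
  down.\<close>

lemma grid_mesh_less:
  assumes "d > 0" "1 / d + 1 < r"
  shows "grid_mesh r < d"
proof -
  have "1 / d < r - 1" using assms(2) by simp
  also have "\<dots> \<le> real (nat \<lfloor>r\<rfloor>)" by linarith
  also have "\<dots> \<le> real (fact (nat \<lfloor>r\<rfloor>))" by (simp only: of_nat_le_iff fact_ge_self)
  also have "\<dots> = fact (nat \<lfloor>r\<rfloor>)" by simp
  finally have "1 / d < fact (nat \<lfloor>r\<rfloor>)" .
  then show ?thesis using assms(1) by (simp add: grid_mesh_def divide_less_eq mult.commute)
qed

theorem theorem4p14:
  fixes e :: "('n::finite) universe \<Rightarrow> 'w"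
    and S :: "'n universe list set \<Rightarrow> 'w list set"
    and N0 :: 'w
    and \<Omega> :: "(real ^ 'n) set"
  assumes "nonstandard_extension e S"
    and "open \<Omega>"
    and "saturated S (distributions \<Omega>)"
    and "infinite_hypernat e S N0"
  shows "\<forall>f \<in> grid_functions S N0 \<Omega>. \<exists>\<nu>.
    parametrized_measure \<Omega> \<nu> \<and>
    (\<forall>\<Psi>\<in>C0b. \<forall>\<phi>\<in>C0c \<Omega>.
       hfinite e S (pairing S N0 \<Omega> (\<lambda>x. hfun1 S \<Psi> (f x)) (hpfun S \<phi>)) \<and>
       std_part e S (pairing S N0 \<Omega> (\<lambda>x. hfun1 S \<Psi> (f x)) (hpfun S \<phi>)) =
         (LINT x:\<Omega>|lebesgue. signed_integral (\<nu> x) \<Psi> * \<phi> x)) \<and>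
    (\<forall>x\<in>\<Omega>. \<forall>A\<in>sets borel. 0 \<le> \<nu> x A \<and> \<nu> x A \<le> 1)"
proof
  fix f assume f: "f \<in> grid_functions S N0 \<Omega>"
  interpret nonstandard e S by standard (rule assms(1))
  have "internal S (hgraph S (grid_dom S N0 \<Omega>) f)"
    using f by (simp only: grid_functions_def mem_Collect_eq)
  then obtain b where b: "hgraph S (grid_dom S N0 \<Omega>) f = {q. star_rel S mem q b}"
    unfolding internal_def ..
  let ?F = "type_filter b N0"
  let ?r = "\<lambda>i :: 'n universe \<times> 'n universe. val (snd i)"
  let ?D = "\<lambda>i. std_grid_dom \<Omega> (?r i)"
  let ?eps = "\<lambda>i. grid_mesh (?r i)"
  have eps0: "(?eps \<longlongrightarrow> 0) ?F"
  proof (rule tendstoI)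
    fix d :: real assume d: "d > 0"
    \<comment> \<open>The 2 turns a non-strict bound into the strict
      \<open>1 / d + 1 < ?r i\<close>.\<close>
    have "eventually (\<lambda>i. 1 / d + 2 \<le> ?r i) ?F"
      unfolding eventually_type_filter by (simp add: infinite_hypernat_ge[OF assms(4)])
    then show "eventually (\<lambda>i. dist (?eps i) 0 < d) ?F"
    proof (rule eventually_mono)
      fix i assume "1 / d + 2 \<le> ?r i"
      then have "?eps i < d" by (intro grid_mesh_less[OF d]) simp
      then show "dist (?eps i) 0 < d" using grid_mesh_pos[of "?r i"] by (simp add: dist_real_def)
    qed
  qed
  \<comment> \<open>Every standard pair serves as an index, even if its first component is no graph.
    The conditions on grids and mesh hold for all real parameters, and arbitrary values of
    \<open>graph_fun\<close> are allowed.\<close>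
  have "\<exists>\<nu>. parametrized_measure \<Omega> \<nu> \<and>
    (\<forall>\<Psi>\<in>C0b. \<forall>\<phi>\<in>C0c \<Omega>.
       ((\<lambda>i. ?eps i ^ CARD('n) * (\<Sum>x\<in>?D i. \<Psi> (graph_fun (fst i) x) * \<phi> x)) \<longlongrightarrow>
         (LINT x:\<Omega>|lebesgue. signed_integral (\<nu> x) \<Psi> * \<phi> x)) ?F) \<and>
    (\<forall>x\<in>\<Omega>. \<forall>A\<in>sets borel. 0 \<le> \<nu> x A \<and> \<nu> x A \<le> 1)"
    by (rule young_measure_along_ultrafilter[OF is_ultrafilter_type_filter assms(2) finite_std_grid_dom
          disjoint_cubes_std_grid _ grid_mesh_pos eps0]) (auto simp: std_grid_dom_def)
  then obtain \<nu> where \<nu>: "parametrized_measure \<Omega> \<nu> \<and>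
    (\<forall>\<Psi>\<in>C0b. \<forall>\<phi>\<in>C0c \<Omega>.
       ((\<lambda>i. ?eps i ^ CARD('n) * (\<Sum>x\<in>?D i. \<Psi> (graph_fun (fst i) x) * \<phi> x)) \<longlongrightarrow>
         (LINT x:\<Omega>|lebesgue. signed_integral (\<nu> x) \<Psi> * \<phi> x)) ?F) \<and>
    (\<forall>x\<in>\<Omega>. \<forall>A\<in>sets borel. 0 \<le> \<nu> x A \<and> \<nu> x A \<le> 1)" ..
  have lim: "((\<lambda>(b, a). grid_mesh (val a) ^ CARD('n) * graph_sum (weight_graph \<Psi> \<phi> b)) \<longlongrightarrow>
      (LINT x:\<Omega>|lebesgue. signed_integral (\<nu> x) \<Psi> * \<phi> x)) ?F"
    if "\<Psi> \<in> C0b" "\<phi> \<in> C0c \<Omega>" for \<Psi> \<phi>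
  proof (rule Lim_transform_eventually)
    show "((\<lambda>i. ?eps i ^ CARD('n) * (\<Sum>x\<in>?D i. \<Psi> (graph_fun (fst i) x) * \<phi> x)) \<longlongrightarrow>
         (LINT x:\<Omega>|lebesgue. signed_integral (\<nu> x) \<Psi> * \<phi> x)) ?F"
      using \<nu> that by simp
    \<comment> \<open>On this large set of pairs, the Riemann sum over the grid is the sum over the
      weighted graph, so both have the same limit.\<close>
    have "eventually (\<lambda>i. graph_on (?D i) (fst i)) ?F"
      unfolding eventually_type_filter using star_graph_on[OF f b] by simp
    then show "eventually (\<lambda>i. ?eps i ^ CARD('n) * (\<Sum>x\<in>?D i. \<Psi> (graph_fun (fst i) x) * \<phi> x) =
        (case i of (b, a) \<Rightarrow> grid_mesh (val a) ^ CARD('n) * graph_sum (weight_graph \<Psi> \<phi> b))) ?F"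
      by (rule eventually_mono) (simp add: graph_sum_weight_graph case_prod_beta)
  qed
  show "\<exists>\<nu>. parametrized_measure \<Omega> \<nu> \<and>
    (\<forall>\<Psi>\<in>C0b. \<forall>\<phi>\<in>C0c \<Omega>.
       hfinite e S (pairing S N0 \<Omega> (\<lambda>x. hfun1 S \<Psi> (f x)) (hpfun S \<phi>)) \<and>
       std_part e S (pairing S N0 \<Omega> (\<lambda>x. hfun1 S \<Psi> (f x)) (hpfun S \<phi>)) =
         (LINT x:\<Omega>|lebesgue. signed_integral (\<nu> x) \<Psi> * \<phi> x)) \<and>
    (\<forall>x\<in>\<Omega>. \<forall>A\<in>sets borel. 0 \<le> \<nu> x A \<and> \<nu> x A \<le> 1)"
  proof (rule exI[of _ \<nu>], intro conjI)
    show "\<forall>\<Psi>\<in>C0b. \<forall>\<phi>\<in>C0c \<Omega>.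
       hfinite e S (pairing S N0 \<Omega> (\<lambda>x. hfun1 S \<Psi> (f x)) (hpfun S \<phi>)) \<and>
       std_part e S (pairing S N0 \<Omega> (\<lambda>x. hfun1 S \<Psi> (f x)) (hpfun S \<phi>)) =
         (LINT x:\<Omega>|lebesgue. signed_integral (\<nu> x) \<Psi> * \<phi> x)"
      unfolding pairing_eq_star2[OF f b]
      by (intro ballI conjI; rule standard_part_eq_limit[OF lim])
  qed (use \<nu> in simp_all)
qed

end
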